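(* Let $M=(M^{2n+s},f,\xi_i,\eta_i,g)$ be a trans-$S$-manifold with associated smooth functions $\alpha_i,\beta_i$ ($i=1,\dots,s$), let $q\neq 0$ be a real constant, and put $\delta=\operatorname{sgn}(-q)$. Let $\gamma:I\to M$ be a Legendre trajectory, i.e. a unit-speed Legendre (Frenet) curve with tangent $T=\gamma'$ satisfying $\nabla_TT=-q\,fT$. Then $\gamma$ is one of the following. 1) A Legendre circle with $\kappa_1=|q|$ and Frenet frame field $\{T,\delta fT\}$. In this case $\alpha_i=0$ and $\beta_i=0$ along $\gamma$ for all $i$. 2) A Legendre curve of osculating order $r\ge 3$ with $$\kappa_1=|q|,\qquad \kappa_2=\sqrt{\sum_{i=1}^s\alpha_i^2},\qquad \kappa_3=\sqrt{\sum_{i=1}^s\left[\left(\frac{\alpha_i}{\sqrt{\sum_{j=1}^s\alpha_j^2}}\right)'\right]^2}$$ (with $\kappa_3=0$ when $r=3$) and Frenet frame field $\{T,\delta fT,E_3,E_4,\dots,E_r\}$, where $$E_3=\frac{\delta}{\sqrt{\sum_{j=1}^s\alpha_j^2}}\sum_{i=1}^s\alpha_i\xi_i,$$ and (when $r\ge 4$) $E_4$ is given by $$\kappa_3E_4=\delta\sum_{i=1}^s\left(\frac{\alpha_i}{\sqrt{\sum_{j=1}^s\alpha_j^2}}\right)'\xi_i .$$ In this case, along $\gamma$, $\alpha_i\ne 0$ for some $i$, and $\beta_i=0$ for all $i$. Moreover, if $r=3$, then there are constants $c_1,\dots,c_s$ with $\sum_{i=1}^sc_i^2=1$ such that $\alpha_i=c_i\sqrt{\sum_{j=1}^s\alpha_j^2}$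 along $\gamma$ for all $i$, and the Frenet frame field is $\{T,\delta fT,E_3\}$.
   Context: A framed metric $f$-manifold $(M^{2n+s},f,\xi_i,\eta_i,g)$ is a $(2n+s)$-dimensional Riemannian manifold $(M,g)$ with a $(1,1)$-tensor field $f$ of rank $2n$, vector fields $\xi_1,\dots,\xi_s$ and 1-forms $\eta_1,\dots,\eta_s$ such that $f^2=-I+\sum_i\eta_i\otimes\xi_i$, $\eta_i(\xi_j)=\delta_{ij}$, $f\xi_i=0$, $\eta_i\circ f=0$, $g(fX,fY)=g(X,Y)-\sum_i\eta_i(X)\eta_i(Y)$, and $\eta_i(X)=g(X,\xi_i)$. It is normal if $[f,f]+2\sum_i d\eta_i\otimes\xi_i=0$, where $[f,f]$ is the Nijenhuis tensor of $f$ and $2d\eta(X,Y)=X\eta(Y)-Y\eta(X)-\eta([X,Y])$. A trans-$S$-manifold is a normal framed metric $f$-manifold for which there are smooth functions $\alpha_i,\beta_i$ ($i=1,\dots,s$) with $$(\nabla_Xf)Y=\sum_{i=1}^s\Big[\alpha_i\{g(fX,fY)\xi_i+\eta_i(Y)f^2X\}+\beta_i\{g(fX,Y)\xi_i-\eta_i(Y)fX\}\Big]$$ for all vector fields $X,Y$, where $\nabla$ is the Levi-Civita connection of $g$. A Frenet curve of osculating order $r$ is a unit-speed curve $\gamma$ with orthonormal fields $E_1=T=\gamma',E_2,\dots,E_r$ along $\gamma$ and positive functions $\kappa_1,\dots,\kappa_{r-1}$ on $I$ with $\nabla_TE_1=\kappa_1E_2$, $\nabla_TE_j=-\kappa_{j-1}E_{j-1}+\kappa_jE_{j+1}$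 ($2\le j\le r-1$), $\nabla_TE_r=-\kappa_{r-1}E_{r-1}$; $\{E_1,\dots,E_r\}$ is its Frenet frame field. A circle is a Frenet curve of osculating order 2 with $\kappa_1$ a non-zero positive constant. All curves are assumed to be Frenet curves. A unit-speed curve is a Legendre curve if $\eta_i(T)=0$ for all $i=1,\dots,s$. Functions $\alpha_i,\beta_i$ in equations along $\gamma$ mean their restrictions to $\gamma$, and $'$ denotes the derivative with respect to the arc-length parameter. *)

theory Defs
  imports "HOL-Analysis.Analysis"
begin

section \<open>Smooth maps between open subsets of normed spaces\<close>

text \<open>These notions are only used on open sets \<open>S\<close>.\<close>

primrec C_k_on :: "nat \<Rightarrow> 'a::real_normed_vector set \<Rightarrow> ('a \<Rightarrow> 'b::real_normed_vector) \<Rightarrow> bool" where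
  "C_k_on 0 S F \<longleftrightarrow> continuous_on S F"
| "C_k_on (Suc k) S F \<longleftrightarrow>
     (\<forall>x\<in>S. F differentiable (at x)) \<and> (\<forall>v. C_k_on k S (\<lambda>x. frechet_derivative F (at x) v))"

definition smooth_on :: "'a::real_normed_vector set \<Rightarrow> ('a \<Rightarrow> 'b::real_normed_vector) \<Rightarrow> bool" where
  "smooth_on S F \<longleftrightarrow> (\<forall>k. C_k_on k S F)"


section \<open>Smooth manifolds\<close>

text \<open>The underlying space of the manifold is the type \<open>'a\<close>, Hausdorff and second countable,
  and the model space is \<open>'e\<close>. A chart is a domain together with a coordinate map.\<close>

type_synonym ('a, 'e) chart = "'a set \<times> ('a \<Rightarrow> 'e)"

abbreviation dom_chart :: "('a, 'e) chart \<Rightarrow> 'a set" where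
  "dom_chart c \<equiv> fst c"

abbreviation coord :: "('a, 'e) chart \<Rightarrow> 'a \<Rightarrow> 'e" where
  "coord c \<equiv> snd c"

definition inv_chart :: "('a, 'e) chart \<Rightarrow> 'e \<Rightarrow> 'a" where
  "inv_chart c = inv_into (dom_chart c) (coord c)"

definition smooth_atlas ::
    "('a::{t2_space, second_countable_topology}, 'e::euclidean_space) chart set \<Rightarrow> bool" where
  "smooth_atlas A \<longleftrightarrow>
     (\<Union>c\<in>A. dom_chart c) = UNIV \<and>
     (\<forall>c\<in>A. open (dom_chart c) \<and> open (coord c ` dom_chart c) \<and>
        homeomorphism (dom_chart c) (coord c ` dom_chart c) (coord c) (inv_chart c)) \<and>
     (\<forall>c\<in>A. \<forall>d\<in>A. smooth_on (coord c ` (dom_chart c \<inter> dom_chart d)) (coord d \<circ> inv_chart c))"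

text \<open>For every point \<open>p\<close> a reference chart around \<open>p\<close> is chosen once and for all. The tangent space
  at \<open>p\<close> is the model space \<open>'e\<close>: a tangent vector at \<open>p\<close> is given by its components in the
  reference chart at \<open>p\<close>. Its components in another chart \<open>c\<close> are obtained from the Jacobian of
  the change of coordinates (\<open>coord_vec\<close>). Reference charts vary with \<open>p\<close> without any continuity,
  so smoothness and derivatives of tangent vector valued maps must always be expressed in a
  fixed chart.\<close>

definition chart_at :: "('a, 'e) chart set \<Rightarrow> 'a \<Rightarrow> ('a, 'e) chart" where
  "chart_at A p = (SOME c. c \<in> A \<and> p \<in> dom_chart c)"

definition coord_vec ::
    "('a, 'e::euclidean_space) chart set \<Rightarrow> ('a, 'e) chart \<Rightarrow> 'a \<Rightarrow> 'e \<Rightarrow> 'e" where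
  "coord_vec A c p v =
     frechet_derivative (coord c \<circ> inv_chart (chart_at A p)) (at (coord (chart_at A p) p)) v"

definition smooth_fun :: "('a, 'e::euclidean_space) chart set \<Rightarrow> ('a \<Rightarrow> real) \<Rightarrow> bool" where
  "smooth_fun A h \<longleftrightarrow> (\<forall>c\<in>A. smooth_on (coord c ` dom_chart c) (h \<circ> inv_chart c))"

definition smooth_vf :: "('a, 'e::euclidean_space) chart set \<Rightarrow> ('a \<Rightarrow> 'e) \<Rightarrow> bool" where
  "smooth_vf A X \<longleftrightarrow>
     (\<forall>c\<in>A. smooth_on (coord c ` dom_chart c)
        (\<lambda>x. coord_vec A c (inv_chart c x) (X (inv_chart c x))))"

text \<open>\<open>tangent_app A p v h\<close> is the derivative \<open>v(h)\<close> of the function \<open>h\<close> in direction of the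
  tangent vector \<open>v\<close> at \<open>p\<close>, and \<open>vf_app A X h\<close> is the function \<open>X(h)\<close>.\<close>

definition tangent_app ::
    "('a, 'e::euclidean_space) chart set \<Rightarrow> 'a \<Rightarrow> 'e \<Rightarrow> ('a \<Rightarrow> real) \<Rightarrow> real" where
  "tangent_app A p v h =
     frechet_derivative (h \<circ> inv_chart (chart_at A p)) (at (coord (chart_at A p) p)) v"

definition vf_app ::
    "('a, 'e::euclidean_space) chart set \<Rightarrow> ('a \<Rightarrow> 'e) \<Rightarrow> ('a \<Rightarrow> real) \<Rightarrow> 'a \<Rightarrow> real" where
  "vf_app A X h = (\<lambda>p. tangent_app A p (X p) h)"

definition lie_bracket ::
    "('a, 'e::euclidean_space) chart set \<Rightarrow> ('a \<Rightarrow> 'e) \<Rightarrow> ('a \<Rightarrow> 'e) \<Rightarrow> 'a \<Rightarrow> 'e" where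
  "lie_bracket A X Y p =
     (THE z. \<forall>h. smooth_fun A h \<longrightarrow>
        tangent_app A p z h = vf_app A X (vf_app A Y h) p - vf_app A Y (vf_app A X h) p)"


section \<open>Tensor fields, Riemannian metrics and the Levi-Civita connection\<close>

text \<open>Tensor fields are given pointwise; as usual, smoothness means that smooth vector fields are
  sent to smooth vector fields or smooth functions.\<close>

definition one_form :: "('a, 'e::euclidean_space) chart set \<Rightarrow> ('a \<Rightarrow> 'e \<Rightarrow> real) \<Rightarrow> bool" where
  "one_form A eta \<longleftrightarrow>
     (\<forall>p. linear (eta p)) \<and> (\<forall>X. smooth_vf A X \<longrightarrow> smooth_fun A (\<lambda>p. eta p (X p)))"

definition tensor_field_1_1 ::
    "('a, 'e::euclidean_space) chart set \<Rightarrow> ('a \<Rightarrow> 'e \<Rightarrow> 'e) \<Rightarrow> bool" where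
  "tensor_field_1_1 A f \<longleftrightarrow>
     (\<forall>p. linear (f p)) \<and> (\<forall>X. smooth_vf A X \<longrightarrow> smooth_vf A (\<lambda>p. f p (X p)))"

definition riemannian_metric ::
    "('a, 'e::euclidean_space) chart set \<Rightarrow> ('a \<Rightarrow> 'e \<Rightarrow> 'e \<Rightarrow> real) \<Rightarrow> bool" where
  "riemannian_metric A g \<longleftrightarrow>
     (\<forall>p. bilinear (g p) \<and> (\<forall>u v. g p u v = g p v u) \<and> (\<forall>v. v \<noteq> 0 \<longrightarrow> g p v v > 0)) \<and>
     (\<forall>X Y. smooth_vf A X \<longrightarrow> smooth_vf A Y \<longrightarrow> smooth_fun A (\<lambda>p. g p (X p) (Y p)))"

text \<open>The operator \<open>nabla\<close> maps \<open>X\<close>, \<open>Y\<close> to \<open>\<nabla>\<^sub>X Y\<close>; only its values on smooth vector fields matter.\<close>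

definition affine_connection ::
    "('a, 'e::euclidean_space) chart set \<Rightarrow> (('a \<Rightarrow> 'e) \<Rightarrow> ('a \<Rightarrow> 'e) \<Rightarrow> 'a \<Rightarrow> 'e) \<Rightarrow> bool" where
  "affine_connection A nabla \<longleftrightarrow>
     (\<forall>X Y. smooth_vf A X \<longrightarrow> smooth_vf A Y \<longrightarrow> smooth_vf A (nabla X Y)) \<and>
     (\<forall>X Z Y p. smooth_vf A X \<longrightarrow> smooth_vf A Z \<longrightarrow> smooth_vf A Y \<longrightarrow>
        nabla (\<lambda>q. X q + Z q) Y p = nabla X Y p + nabla Z Y p) \<and>
     (\<forall>h X Y p. smooth_fun A h \<longrightarrow> smooth_vf A X \<longrightarrow> smooth_vf A Y \<longrightarrow>
        nabla (\<lambda>q. h q *\<^sub>R X q) Y p = h p *\<^sub>R nabla X Y p) \<and>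
     (\<forall>X Y Z p. smooth_vf A X \<longrightarrow> smooth_vf A Y \<longrightarrow> smooth_vf A Z \<longrightarrow>
        nabla X (\<lambda>q. Y q + Z q) p = nabla X Y p + nabla X Z p) \<and>
     (\<forall>h X Y p. smooth_fun A h \<longrightarrow> smooth_vf A X \<longrightarrow> smooth_vf A Y \<longrightarrow>
        nabla X (\<lambda>q. h q *\<^sub>R Y q) p = vf_app A X h p *\<^sub>R Y p + h p *\<^sub>R nabla X Y p)"

definition levi_civita_connection ::
    "('a, 'e::euclidean_space) chart set \<Rightarrow> ('a \<Rightarrow> 'e \<Rightarrow> 'e \<Rightarrow> real) \<Rightarrow>
     (('a \<Rightarrow> 'e) \<Rightarrow> ('a \<Rightarrow> 'e) \<Rightarrow> 'a \<Rightarrow> 'e) \<Rightarrow> bool" where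
  "levi_civita_connection A g nabla \<longleftrightarrow>
     affine_connection A nabla \<and>
     (\<forall>X Y p. smooth_vf A X \<longrightarrow> smooth_vf A Y \<longrightarrow>
        nabla X Y p - nabla Y X p = lie_bracket A X Y p) \<and>
     (\<forall>X Y Z p. smooth_vf A X \<longrightarrow> smooth_vf A Y \<longrightarrow> smooth_vf A Z \<longrightarrow>
        vf_app A X (\<lambda>q. g q (Y q) (Z q)) p = g p (nabla X Y p) (Z p) + g p (Y p) (nabla X Z p))"


section \<open>Framed metric \<open>f\<close>-manifolds and trans-\<open>S\<close>-manifolds\<close>

definition framed_metric_f_manifold ::
    "('a::{t2_space, second_countable_topology}, 'e::euclidean_space) chart set \<Rightarrow> nat \<Rightarrow> nat \<Rightarrow>
     ('a \<Rightarrow> 'e \<Rightarrow> 'e) \<Rightarrow> (nat \<Rightarrow> 'a \<Rightarrow> 'e) \<Rightarrow> (nat \<Rightarrow> 'a \<Rightarrow> 'e \<Rightarrow> real) \<Rightarrow>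
     ('a \<Rightarrow> 'e \<Rightarrow> 'e \<Rightarrow> real) \<Rightarrow> bool" where
  "framed_metric_f_manifold A n s f xi eta g \<longleftrightarrow>
     smooth_atlas A \<and> DIM('e) = 2 * n + s \<and>
     riemannian_metric A g \<and>
     tensor_field_1_1 A f \<and> (\<forall>p. dim (range (f p)) = 2 * n) \<and>
     (\<forall>i\<in>{1..s}. smooth_vf A (xi i) \<and> one_form A (eta i)) \<and>
     (\<forall>p v. f p (f p v) = - v + (\<Sum>i=1..s. eta i p v *\<^sub>R xi i p)) \<and>
     (\<forall>p. \<forall>i\<in>{1..s}. \<forall>j\<in>{1..s}. eta i p (xi j p) = (if i = j then 1 else 0)) \<and>
     (\<forall>p. \<forall>i\<in>{1..s}. f p (xi i p) = 0) \<and>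
     (\<forall>p v. \<forall>i\<in>{1..s}. eta i p (f p v) = 0) \<and>
     (\<forall>p u v. g p (f p u) (f p v) = g p u v - (\<Sum>i=1..s. eta i p u * eta i p v)) \<and>
     (\<forall>p v. \<forall>i\<in>{1..s}. eta i p v = g p v (xi i p))"

definition nijenhuis ::
    "('a, 'e::euclidean_space) chart set \<Rightarrow> ('a \<Rightarrow> 'e \<Rightarrow> 'e) \<Rightarrow>
     ('a \<Rightarrow> 'e) \<Rightarrow> ('a \<Rightarrow> 'e) \<Rightarrow> 'a \<Rightarrow> 'e" where
  "nijenhuis A f X Y p =
     f p (f p (lie_bracket A X Y p))
     + lie_bracket A (\<lambda>q. f q (X q)) (\<lambda>q. f q (Y q)) p
     - f p (lie_bracket A (\<lambda>q. f q (X q)) Y p)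
     - f p (lie_bracket A X (\<lambda>q. f q (Y q)) p)"

definition ext_deriv ::
    "('a, 'e::euclidean_space) chart set \<Rightarrow> ('a \<Rightarrow> 'e \<Rightarrow> real) \<Rightarrow>
     ('a \<Rightarrow> 'e) \<Rightarrow> ('a \<Rightarrow> 'e) \<Rightarrow> 'a \<Rightarrow> real" where
  "ext_deriv A eta X Y p =
     (vf_app A X (\<lambda>q. eta q (Y q)) p - vf_app A Y (\<lambda>q. eta q (X q)) p
      - eta p (lie_bracket A X Y p)) / 2"

definition normal_structure ::
    "('a, 'e::euclidean_space) chart set \<Rightarrow> nat \<Rightarrow>
     ('a \<Rightarrow> 'e \<Rightarrow> 'e) \<Rightarrow> (nat \<Rightarrow> 'a \<Rightarrow> 'e) \<Rightarrow> (nat \<Rightarrow> 'a \<Rightarrow> 'e \<Rightarrow> real) \<Rightarrow> bool" where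
  "normal_structure A s f xi eta \<longleftrightarrow>
     (\<forall>X Y p. smooth_vf A X \<longrightarrow> smooth_vf A Y \<longrightarrow>
        nijenhuis A f X Y p + 2 *\<^sub>R (\<Sum>i=1..s. ext_deriv A (eta i) X Y p *\<^sub>R xi i p) = 0)"

text \<open>\<open>cov_deriv_tensor nabla f X Y\<close> is \<open>(\<nabla>\<^sub>X f) Y\<close>.\<close>

definition cov_deriv_tensor ::
    "(('a \<Rightarrow> 'e) \<Rightarrow> ('a \<Rightarrow> 'e) \<Rightarrow> 'a \<Rightarrow> 'e::euclidean_space) \<Rightarrow> ('a \<Rightarrow> 'e \<Rightarrow> 'e) \<Rightarrow>
     ('a \<Rightarrow> 'e) \<Rightarrow> ('a \<Rightarrow> 'e) \<Rightarrow> 'a \<Rightarrow> 'e" where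
  "cov_deriv_tensor nabla f X Y p = nabla X (\<lambda>q. f q (Y q)) p - f p (nabla X Y p)"

definition trans_S_manifold ::
    "('a::{t2_space, second_countable_topology}, 'e::euclidean_space) chart set \<Rightarrow> nat \<Rightarrow> nat \<Rightarrow>
     ('a \<Rightarrow> 'e \<Rightarrow> 'e) \<Rightarrow> (nat \<Rightarrow> 'a \<Rightarrow> 'e) \<Rightarrow> (nat \<Rightarrow> 'a \<Rightarrow> 'e \<Rightarrow> real) \<Rightarrow>
     ('a \<Rightarrow> 'e \<Rightarrow> 'e \<Rightarrow> real) \<Rightarrow> (('a \<Rightarrow> 'e) \<Rightarrow> ('a \<Rightarrow> 'e) \<Rightarrow> 'a \<Rightarrow> 'e) \<Rightarrow>
     (nat \<Rightarrow> 'a \<Rightarrow> real) \<Rightarrow> (nat \<Rightarrow> 'a \<Rightarrow> real) \<Rightarrow> bool" where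
  "trans_S_manifold A n s f xi eta g nabla alpha beta \<longleftrightarrow>
     framed_metric_f_manifold A n s f xi eta g \<and>
     normal_structure A s f xi eta \<and>
     levi_civita_connection A g nabla \<and>
     (\<forall>i\<in>{1..s}. smooth_fun A (alpha i) \<and> smooth_fun A (beta i)) \<and>
     (\<forall>X Y p. smooth_vf A X \<longrightarrow> smooth_vf A Y \<longrightarrow>
        cov_deriv_tensor nabla f X Y p =
          (\<Sum>i=1..s.
             alpha i p *\<^sub>R (g p (f p (X p)) (f p (Y p)) *\<^sub>R xi i p + eta i p (Y p) *\<^sub>R f p (f p (X p)))
             + beta i p *\<^sub>R (g p (f p (X p)) (Y p) *\<^sub>R xi i p - eta i p (Y p) *\<^sub>R f p (X p))))"


section \<open>Curves\<close>

text \<open>Curves are parametrized by an open interval \<open>I\<close>, possibly unbounded; curves and fields along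
  them are total functions of which only the values on \<open>I\<close> matter.\<close>

definition smooth_curve ::
    "('a::topological_space, 'e::euclidean_space) chart set \<Rightarrow> real set \<Rightarrow> (real \<Rightarrow> 'a) \<Rightarrow> bool" where
  "smooth_curve A I \<gamma> \<longleftrightarrow>
     open I \<and> is_interval I \<and> I \<noteq> {} \<and> continuous_on I \<gamma> \<and>
     (\<forall>c\<in>A. smooth_on (I \<inter> \<gamma> -` dom_chart c) (coord c \<circ> \<gamma>))"

definition velocity :: "('a, 'e::euclidean_space) chart set \<Rightarrow> (real \<Rightarrow> 'a) \<Rightarrow> real \<Rightarrow> 'e" where
  "velocity A \<gamma> t = vector_derivative (coord (chart_at A (\<gamma> t)) \<circ> \<gamma>) (at t)"

definition smooth_field_along ::
    "('a, 'e::euclidean_space) chart set \<Rightarrow> real set \<Rightarrow> (real \<Rightarrow> 'a) \<Rightarrow> (real \<Rightarrow> 'e) \<Rightarrow> bool" where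
  "smooth_field_along A I \<gamma> V \<longleftrightarrow>
     (\<forall>c\<in>A. smooth_on (I \<inter> \<gamma> -` dom_chart c) (\<lambda>t. coord_vec A c (\<gamma> t) (V t)))"

text \<open>The covariant derivative \<open>D\<close> along \<open>\<gamma>\<close> induced by \<open>nabla\<close> (written \<open>\<nabla>\<^sub>T\<close>, with \<open>T = \<gamma>'\<close>): the
  operator on smooth fields along \<open>\<gamma>\<close> that is additive, satisfies the product rule, and maps the
  restriction to \<open>\<gamma>\<close> of a vector field \<open>Y\<close> to \<open>\<nabla>\<^sub>X Y\<close> at every point where \<open>X\<close> agrees
  with \<open>\<gamma>'\<close>. These conditions determine \<open>D\<close> on \<open>I\<close>.\<close>

definition cov_deriv_along ::
    "('a, 'e::euclidean_space) chart set \<Rightarrow> (('a \<Rightarrow> 'e) \<Rightarrow> ('a \<Rightarrow> 'e) \<Rightarrow> 'a \<Rightarrow> 'e) \<Rightarrow>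
     real set \<Rightarrow> (real \<Rightarrow> 'a) \<Rightarrow> ((real \<Rightarrow> 'e) \<Rightarrow> real \<Rightarrow> 'e) \<Rightarrow> bool" where
  "cov_deriv_along A nabla I \<gamma> D \<longleftrightarrow>
     (\<forall>V. smooth_field_along A I \<gamma> V \<longrightarrow> smooth_field_along A I \<gamma> (D V)) \<and>
     (\<forall>V W. smooth_field_along A I \<gamma> V \<longrightarrow> smooth_field_along A I \<gamma> W \<longrightarrow>
        (\<forall>t\<in>I. D (\<lambda>u. V u + W u) t = D V t + D W t)) \<and>
     (\<forall>h V. smooth_on I h \<longrightarrow> smooth_field_along A I \<gamma> V \<longrightarrow>
        (\<forall>t\<in>I. D (\<lambda>u. h u *\<^sub>R V u) t = deriv h t *\<^sub>R V t + h t *\<^sub>R D V t)) \<and>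
     (\<forall>X Y. smooth_vf A X \<longrightarrow> smooth_vf A Y \<longrightarrow>
        (\<forall>t\<in>I. X (\<gamma> t) = velocity A \<gamma> t \<longrightarrow> D (\<lambda>u. Y (\<gamma> u)) t = nabla X Y (\<gamma> t)))"

text \<open>In the following \<open>D\<close> is the covariant derivative along \<open>\<gamma>\<close>. The Frenet frame is
  \<open>E 1, \<dots>, E r\<close> and the curvatures are \<open>\<kappa> 1, \<dots>, \<kappa> (r - 1)\<close>; for \<open>r = 1\<close> the equations say that
  \<open>\<gamma>\<close> is a geodesic.\<close>

definition frenet_curve ::
    "('a::topological_space, 'e::euclidean_space) chart set \<Rightarrow> ('a \<Rightarrow> 'e \<Rightarrow> 'e \<Rightarrow> real) \<Rightarrow>
     real set \<Rightarrow> (real \<Rightarrow> 'a) \<Rightarrow> ((real \<Rightarrow> 'e) \<Rightarrow> real \<Rightarrow> 'e) \<Rightarrow>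
     nat \<Rightarrow> (nat \<Rightarrow> real \<Rightarrow> 'e) \<Rightarrow> (nat \<Rightarrow> real \<Rightarrow> real) \<Rightarrow> bool" where
  "frenet_curve A g I \<gamma> D r E \<kappa> \<longleftrightarrow>
     smooth_curve A I \<gamma> \<and> r \<ge> 1 \<and>
     (\<forall>t\<in>I. g (\<gamma> t) (velocity A \<gamma> t) (velocity A \<gamma> t) = 1) \<and>
     (\<forall>j\<in>{1..r}. smooth_field_along A I \<gamma> (E j)) \<and>
     (\<forall>t\<in>I. E 1 t = velocity A \<gamma> t) \<and>
     (\<forall>t\<in>I. \<forall>i\<in>{1..r}. \<forall>j\<in>{1..r}. g (\<gamma> t) (E i t) (E j t) = (if i = j then 1 else 0)) \<and>
     (\<forall>t\<in>I. \<forall>j\<in>{1..<r}. \<kappa> j t > 0) \<and>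
     (\<forall>t\<in>I. \<forall>j\<in>{1..r}. D (E j) t =
        (if j = 1 then 0 else - (\<kappa> (j - 1) t *\<^sub>R E (j - 1) t)) +
        (if j = r then 0 else \<kappa> j t *\<^sub>R E (j + 1) t))"

definition frenet_circle ::
    "('a::topological_space, 'e::euclidean_space) chart set \<Rightarrow> ('a \<Rightarrow> 'e \<Rightarrow> 'e \<Rightarrow> real) \<Rightarrow>
     real set \<Rightarrow> (real \<Rightarrow> 'a) \<Rightarrow> ((real \<Rightarrow> 'e) \<Rightarrow> real \<Rightarrow> 'e) \<Rightarrow>
     nat \<Rightarrow> (nat \<Rightarrow> real \<Rightarrow> 'e) \<Rightarrow> (nat \<Rightarrow> real \<Rightarrow> real) \<Rightarrow> bool" where
  "frenet_circle A g I \<gamma> D r E \<kappa> \<longleftrightarrow>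
     frenet_curve A g I \<gamma> D r E \<kappa> \<and> r = 2 \<and> (\<exists>k>0. \<forall>t\<in>I. \<kappa> 1 t = k)"

definition legendre_curve ::
    "('a::topological_space, 'e::euclidean_space) chart set \<Rightarrow> nat \<Rightarrow>
     (nat \<Rightarrow> 'a \<Rightarrow> 'e \<Rightarrow> real) \<Rightarrow> ('a \<Rightarrow> 'e \<Rightarrow> 'e \<Rightarrow> real) \<Rightarrow>
     real set \<Rightarrow> (real \<Rightarrow> 'a) \<Rightarrow> bool" where
  "legendre_curve A s eta g I \<gamma> \<longleftrightarrow>
     smooth_curve A I \<gamma> \<and>
     (\<forall>t\<in>I. g (\<gamma> t) (velocity A \<gamma> t) (velocity A \<gamma> t) = 1) \<and>
     (\<forall>t\<in>I. \<forall>i\<in>{1..s}. eta i (\<gamma> t) (velocity A \<gamma> t) = 0)"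

end

theory Submission
  imports Defs "HOL-Computational_Algebra.Polynomial"
begin

text \<open>The horizontality of \<open>T\<close> and the normality of the structure give
  \<open>\<nabla>\<^sub>T \<xi>\<^sub>i = - \<alpha>\<^sub>i f T + \<beta>\<^sub>i T\<close>: the formula for \<open>\<nabla> f\<close> determines \<open>f (\<nabla>\<^sub>T \<xi>\<^sub>i)\<close>, and normality
  kills the \<open>\<xi>\<close> components. Differentiating \<open>g(T, \<xi>\<^sub>i) = 0\<close> then yields \<open>\<beta>\<^sub>i = 0\<close>. The trajectory
  equation gives \<open>E\<^sub>2 = \<delta> f T\<close>, and \<open>\<nabla>\<^sub>T (f T) = \<Sum> \<alpha>\<^sub>i \<xi>\<^sub>i + q T\<close> gives \<open>\<kappa>\<^sub>2 E\<^sub>3 = \<delta> \<Sum> \<alpha>\<^sub>i \<xi>\<^sub>i\<close>;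
  differentiating this once more gives \<open>\<kappa>\<^sub>3 E\<^sub>4\<close>. Since \<open>\<nabla>\<close> acts on global vector fields and the
  covariant derivative along \<open>\<gamma>\<close> is only characterized through them, bump functions are needed
  to extend tangent vectors and to expand fields along \<open>\<gamma>\<close> in global fields.\<close>

section \<open>Calculus of smooth maps\<close>

text \<open>Since \<open>S\<close> is open, agreement on \<open>S\<close> is agreement near each of
  its points. The derivatives, taken at the full filter \<open>at x\<close>, therefore agree on
  \<open>S\<close> too and the induction continues.\<close>

lemma C_k_on_cong:
  assumes "open S" "\<And>x. x \<in> S \<Longrightarrow> F x = G x"
  shows "C_k_on k S F \<longleftrightarrow> C_k_on k S G"
proof -
  have imp: "C_k_on k S G" if "C_k_on k S F" "\<And>x. x \<in> S \<Longrightarrow> F x = G x" for F G :: "'a \<Rightarrow> 'b"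
    using that
  proof (induction k arbitrary: F G)
    case 0
    then show ?case by (simp cong: continuous_on_cong)
  next
    case (Suc k)
    have deriv: "(G has_derivative frechet_derivative F (at x)) (at x)" if "x \<in> S" for x
    proof (rule has_derivative_transform_within_open[OF _ \<open>open S\<close> that])
      show "(F has_derivative frechet_derivative F (at x)) (at x)"
        using Suc.prems that frechet_derivative_works by auto
    qed (use Suc.prems in auto)
    have eq: "frechet_derivative F (at x) = frechet_derivative G (at x)" if "x \<in> S" for x
      using frechet_derivative_at deriv that by blast
    have "C_k_on k S (\<lambda>x. frechet_derivative G (at x) v)" for v
      by (rule Suc.IH[of "\<lambda>x. frechet_derivative F (at x) v"]) (use Suc.prems eq in auto)
    then show ?case using deriv by (auto simp: differentiable_def)
  qed
  show ?thesis
    using imp[of F G] imp[of G F] assms(2) by metis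
qed

text \<open>Uniqueness of the derivative allows it to be supplied in any closed form
  \<open>F'\<close> instead of the \<open>frechet_derivative\<close> of the definition.\<close>

lemma C_k_on_SucI:
  assumes "open S" "\<And>x. x \<in> S \<Longrightarrow> (F has_derivative F' x) (at x)"
    and "\<And>v. C_k_on k S (\<lambda>x. F' x v)"
  shows "C_k_on (Suc k) S F"
proof -
  have "C_k_on k S (\<lambda>x. frechet_derivative F (at x) v)" for v
    using C_k_on_cong[OF assms(1), of "\<lambda>x. F' x v" "\<lambda>x. frechet_derivative F (at x) v" k]
      assms(2,3) frechet_derivative_at by metis
  then show ?thesis using assms(2) by (auto simp: differentiable_def)
qed

lemma C_k_on_has_derivative:
  "C_k_on (Suc k) S F \<Longrightarrow> x \<in> S \<Longrightarrow> (F has_derivative frechet_derivative F (at x)) (at x)"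
  using frechet_derivative_works by auto

lemma C_k_on_SucD: "C_k_on (Suc k) S F \<Longrightarrow> C_k_on k S F"
proof (induction k arbitrary: F)
  case 0
  then show ?case
    by (auto intro!: differentiable_imp_continuous_on differentiable_at_imp_differentiable_on)
qed simp

lemma C_k_on_const: "C_k_on k S (\<lambda>x. c)"
  by (induction k arbitrary: c) (auto simp: continuous_on_const)

lemma C_k_on_bounded_linear:
  assumes "bounded_linear L" "open S" "C_k_on k S F"
  shows "C_k_on k S (\<lambda>x. L (F x))"
  using assms(3)
proof (induction k arbitrary: F)
  case 0
  then show ?case using assms(1) by (auto intro: bounded_linear.continuous_on)
next
  case (Suc k)
  show ?case
    by (rule C_k_on_SucI[OF assms(2)
          bounded_linear.has_derivative[OF assms(1) C_k_on_has_derivative[OF Suc.prems]]])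
      (use Suc in auto)
qed

lemma C_k_on_add:
  assumes "open S" "C_k_on k S F" "C_k_on k S G"
  shows "C_k_on k S (\<lambda>x. F x + G x)"
  using assms(2,3)
proof (induction k arbitrary: F G)
  case 0
  then show ?case by (auto intro: continuous_on_add)
next
  case (Suc k)
  show ?case
    by (rule C_k_on_SucI[OF assms(1)
          has_derivative_add[OF C_k_on_has_derivative[OF Suc.prems(1)]
            C_k_on_has_derivative[OF Suc.prems(2)]]])
      (use Suc in auto)
qed

lemma C_k_on_sum:
  assumes "open S" "\<And>i. i \<in> J \<Longrightarrow> C_k_on k S (F i)"
  shows "C_k_on k S (\<lambda>x. \<Sum>i\<in>J. F i x)"
  using assms(2)
proof (induction J rule: infinite_finite_induct)
  case (insert i J)
  have "C_k_on k S (F i)" "C_k_on k S (\<lambda>x. \<Sum>i\<in>J. F i x)"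
    using insert by blast+
  then show ?case
    using insert(1,2) C_k_on_add[OF assms(1), of k "F i" "\<lambda>x. \<Sum>i\<in>J. F i x"] by simp
qed (simp_all add: C_k_on_const)

lemma C_k_on_bounded_bilinear:
  assumes B: "bounded_bilinear B" and "open S" "C_k_on k S F" "C_k_on k S G"
  shows "C_k_on k S (\<lambda>x. B (F x) (G x))"
  using assms(3,4)
proof (induction k arbitrary: F G)
  case 0
  then show ?case by (auto intro: bounded_bilinear.continuous_on[OF B])
next
  case (Suc k)
  have "C_k_on k S (\<lambda>x. B (F x) (frechet_derivative G (at x) v) + B (frechet_derivative F (at x) v) (G x))"
    for v
    using Suc.prems by (intro C_k_on_add[OF \<open>open S\<close>] Suc.IH C_k_on_SucD[OF Suc.prems(1)]
        C_k_on_SucD[OF Suc.prems(2)]) auto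
  then show ?case
    by (intro C_k_on_SucI[OF \<open>open S\<close>, of _ "\<lambda>x h. B (F x) (frechet_derivative G (at x) h)
          + B (frechet_derivative F (at x) h) (G x)"]
        bounded_bilinear.FDERIV[OF B]
          C_k_on_has_derivative[OF Suc.prems(1)] C_k_on_has_derivative[OF Suc.prems(2)])
qed

lemma C_k_on_subset:
  "C_k_on k S F \<Longrightarrow> U \<subseteq> S \<Longrightarrow> C_k_on k U F"
  by (induction k arbitrary: F) (auto intro: continuous_on_subset)

lemma C_k_on_local:
  assumes "\<And>x. x \<in> S \<Longrightarrow> \<exists>U. open U \<and> x \<in> U \<and> C_k_on k U F"
  shows "C_k_on k S F"
  using assms
proof (induction k arbitrary: F)
  case 0
  then show ?case
    by (metis C_k_on.simps(1) continuous_on_eq_continuous_at continuous_at_imp_continuous_on)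
next
  case (Suc k)
  then show ?case by simp meson
qed

text \<open>The chain rule evaluates the derivative of \<open>G\<close> in a direction that varies
  with \<open>x\<close>, whereas \<open>C_k_on\<close> controls fixed directions only. Expanding the
  varying direction in the finite basis of the intermediate space leaves fixed directions with
  coefficients of class \<open>k\<close>.\<close>

lemma C_k_on_compose:
  fixes F :: "'a::real_normed_vector \<Rightarrow> 'b::euclidean_space" and G :: "'b \<Rightarrow> 'c::real_normed_vector"
  assumes "open S" "C_k_on k S F" "C_k_on k U G" "F ` S \<subseteq> U"
  shows "C_k_on k S (\<lambda>x. G (F x))"
  using assms(2-4)
proof (induction k arbitrary: G)
  case 0
  then show ?case using continuous_on_compose2 by auto
next
  case (Suc k)
  have F: "(F has_derivative frechet_derivative F (at x)) (at x)" if "x \<in> S" for x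
    using C_k_on_has_derivative[OF Suc.prems(1) that] .
  have G: "(G has_derivative frechet_derivative G (at (F x))) (at (F x))" if "x \<in> S" for x
    using C_k_on_has_derivative[OF Suc.prems(2)] Suc.prems(3) that by blast
  have lin: "frechet_derivative G (at (F x)) (frechet_derivative F (at x) v) =
      (\<Sum>b\<in>Basis. (frechet_derivative F (at x) v \<bullet> b) *\<^sub>R frechet_derivative G (at (F x)) b)"
    if "x \<in> S" for x v
  proof -
    interpret linear "frechet_derivative G (at (F x))"
      using G[OF that] has_derivative_linear by blast
    show ?thesis
      by (subst euclidean_representation[symmetric, of "frechet_derivative F (at x) v"])
        (simp only: sum scale)
  qed
  have "C_k_on k S (\<lambda>x. \<Sum>b\<in>Basis.
      (frechet_derivative F (at x) v \<bullet> b) *\<^sub>R frechet_derivative G (at (F x)) b)" for v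
  proof (intro C_k_on_sum[OF \<open>open S\<close>]
      C_k_on_bounded_bilinear[OF bounded_bilinear_scaleR \<open>open S\<close>])
    fix b :: 'b
    show "C_k_on k S (\<lambda>x. frechet_derivative F (at x) v \<bullet> b)"
      using Suc.prems(1)
      by (intro C_k_on_bounded_linear[OF bounded_linear_inner_left \<open>open S\<close>]) auto
    show "C_k_on k S (\<lambda>x. frechet_derivative G (at (F x)) b)"
      using Suc.prems C_k_on_SucD[OF Suc.prems(1)] by (intro Suc.IH) auto
  qed
  then have *: "C_k_on k S (\<lambda>x. frechet_derivative G (at (F x)) (frechet_derivative F (at x) v))" for v
    by (subst C_k_on_cong[OF \<open>open S\<close> lin])
  show ?case
    by (rule C_k_on_SucI[OF \<open>open S\<close> has_derivative_compose[OF F G]]) (use * in auto)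
qed

section \<open>Infinitely differentiable maps\<close>

lemma smooth_on_cong:
  "open S \<Longrightarrow> (\<And>x. x \<in> S \<Longrightarrow> F x = G x) \<Longrightarrow> smooth_on S F \<longleftrightarrow> smooth_on S G"
  unfolding smooth_on_def using C_k_on_cong by blast

lemma smooth_on_const: "smooth_on S (\<lambda>x. c)"
  by (simp add: smooth_on_def C_k_on_const)

lemma smooth_on_add: "open S \<Longrightarrow> smooth_on S F \<Longrightarrow> smooth_on S G \<Longrightarrow> smooth_on S (\<lambda>x. F x + G x)"
  by (simp add: smooth_on_def C_k_on_add)

lemma smooth_on_sum:
  "open S \<Longrightarrow> (\<And>i. i \<in> J \<Longrightarrow> smooth_on S (F i)) \<Longrightarrow> smooth_on S (\<lambda>x. \<Sum>i\<in>J. F i x)"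
  by (simp add: smooth_on_def C_k_on_sum)

lemma smooth_on_bounded_linear:
  "bounded_linear L \<Longrightarrow> open S \<Longrightarrow> smooth_on S F \<Longrightarrow> smooth_on S (\<lambda>x. L (F x))"
  by (simp add: smooth_on_def C_k_on_bounded_linear)

lemma smooth_on_scaleR:
  "open S \<Longrightarrow> smooth_on S F \<Longrightarrow> smooth_on S G \<Longrightarrow> smooth_on S (\<lambda>x. F x *\<^sub>R G x)"
  by (simp add: smooth_on_def C_k_on_bounded_bilinear[OF bounded_bilinear_scaleR])

lemma smooth_on_mult:
  fixes F G :: "_ \<Rightarrow> real"
  shows "open S \<Longrightarrow> smooth_on S F \<Longrightarrow> smooth_on S G \<Longrightarrow> smooth_on S (\<lambda>x. F x * G x)"
  using smooth_on_scaleR[of S F G] by simp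

lemma smooth_on_subset: "smooth_on S F \<Longrightarrow> U \<subseteq> S \<Longrightarrow> smooth_on U F"
  unfolding smooth_on_def using C_k_on_subset by blast

lemma smooth_on_local:
  "(\<And>x. x \<in> S \<Longrightarrow> \<exists>U. open U \<and> x \<in> U \<and> smooth_on U F) \<Longrightarrow> smooth_on S F"
  unfolding smooth_on_def using C_k_on_local by metis

lemma smooth_on_compose:
  fixes F :: "'a::real_normed_vector \<Rightarrow> 'b::euclidean_space" and G :: "'b \<Rightarrow> 'c::real_normed_vector"
  shows "open S \<Longrightarrow> smooth_on S F \<Longrightarrow> smooth_on U G \<Longrightarrow> F ` S \<subseteq> U \<Longrightarrow> smooth_on S (\<lambda>x. G (F x))"
  unfolding smooth_on_def using C_k_on_compose by blast

lemma smooth_on_has_derivative: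
  "smooth_on S F \<Longrightarrow> x \<in> S \<Longrightarrow> (F has_derivative frechet_derivative F (at x)) (at x)"
  unfolding smooth_on_def using C_k_on_has_derivative by blast

lemma smooth_on_frechet_derivative:
  "smooth_on S F \<Longrightarrow> smooth_on S (\<lambda>x. frechet_derivative F (at x) v)"
  unfolding smooth_on_def by (metis C_k_on.simps(2))

lemma smooth_on_DERIV:
  fixes h :: "real \<Rightarrow> real"
  assumes "smooth_on S h" "t \<in> S"
  shows "(h has_real_derivative deriv h t) (at t)"
proof -
  have "h differentiable (at t)"
    using smooth_on_has_derivative[OF assms] differentiable_def by blast
  then show ?thesis
    using DERIV_deriv_iff_real_differentiable by blast
qed

lemma smooth_on_id: "open S \<Longrightarrow> smooth_on S (\<lambda>x. x)"
proof -
  assume "open S"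
  have "C_k_on k S (\<lambda>x. x)" for k
  proof (cases k)
    case (Suc m)
    show ?thesis
      unfolding Suc by (rule C_k_on_SucI[OF \<open>open S\<close> has_derivative_ident]) (rule C_k_on_const)
  qed simp
  then show ?thesis by (simp add: smooth_on_def)
qed

text \<open>The derivative of a power is a multiple of a power with another exponent, so the
  induction runs over all \<open>a\<close> at once.\<close>

lemma smooth_on_powr: "smooth_on {0<..} (\<lambda>x::real. x powr a)"
proof -
  have "C_k_on k {0<..} (\<lambda>x::real. x powr a)" for k
  proof (induction k arbitrary: a)
    case 0
    show ?case by (auto intro!: continuous_intros)
  next
    case (Suc k)
    show ?case
    proof (rule C_k_on_SucI)
      show "((\<lambda>x. x powr a) has_derivative (\<lambda>v. v * (a * x powr (a - 1)))) (at x)"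
        if "x \<in> {0<..}" for x :: real
        using has_real_derivative_powr[of x a] that
        by (auto simp: has_field_derivative_def mult_commute_abs)
      show "C_k_on k {0<..} (\<lambda>x::real. v * (a * x powr (a - 1)))" for v
        using C_k_on_bounded_linear[OF bounded_linear_mult_right[of "v * a"], of "{0<..}" k
            "\<lambda>x. x powr (a - 1)"] Suc.IH by (simp add: mult.assoc)
    qed simp
  qed
  then show ?thesis by (simp add: smooth_on_def)
qed

text \<open>The normalized coefficients of \<open>E 3\<close> have this form, and they must be
  smooth for the product rule along the curve. The sum of squares stays positive, where
  \<open>powr\<close> with exponent -1/2 is smooth.\<close>

lemma smooth_on_divide_norm:
  fixes F :: "'j \<Rightarrow> 'a::real_normed_vector \<Rightarrow> real"
  assumes S: "open S" and F: "\<And>j. j \<in> J \<Longrightarrow> smooth_on S (F j)" and i: "i \<in> J"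
    and pos: "\<And>x. x \<in> S \<Longrightarrow> 0 < (\<Sum>j\<in>J. (F j x)\<^sup>2)"
  shows "smooth_on S (\<lambda>x. F i x / sqrt (\<Sum>j\<in>J. (F j x)\<^sup>2))"
proof -
  define w where "w = (\<lambda>x. \<Sum>j\<in>J. F j x * F j x)"
  have w_pos: "0 < w x" if "x \<in> S" for x
    using pos[OF that] by (simp add: w_def power2_eq_square)
  have w: "smooth_on S w"
    unfolding w_def
  proof (rule smooth_on_sum[OF S])
    show "smooth_on S (\<lambda>x. F j x * F j x)" if "j \<in> J" for j
      by (rule smooth_on_mult[OF S F[OF that] F[OF that]])
  qed
  have "w ` S \<subseteq> {0<..}"
    using w_pos by auto
  then have "smooth_on S (\<lambda>x. w x powr (- (1/2)))"
    by (rule smooth_on_compose[OF S w smooth_on_powr])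
  then have *: "smooth_on S (\<lambda>x. F i x * w x powr (- (1/2)))"
    by (rule smooth_on_mult[OF S F[OF i]])
  have eq: "F i x / sqrt (\<Sum>j\<in>J. (F j x)\<^sup>2) = F i x * w x powr (- (1/2))" if "x \<in> S" for x
  proof -
    have "w x powr (- (1/2)) = inverse (sqrt (w x))"
      using w_pos[OF that] by (simp add: powr_minus powr_half_sqrt)
    moreover have "(\<Sum>j\<in>J. (F j x)\<^sup>2) = w x"
      by (simp add: w_def power2_eq_square)
    ultimately show ?thesis by (metis divide_inverse)
  qed
  show ?thesis
    using smooth_on_cong[OF S, of "\<lambda>x. F i x / sqrt (\<Sum>j\<in>J. (F j x)\<^sup>2)"
        "\<lambda>x. F i x * w x powr (- (1/2))"] eq * by simp
qed

text \<open>The functions \<open>P(1/x) exp(-1/x)\<close>, extended by zero to \<open>x \<le> 0\<close>, are closed under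
  differentiation.\<close>

lemma smooth_on_exp_bump:
  "smooth_on UNIV (\<lambda>x::real. if x > 0 then exp (- inverse x) else 0)"
proof -
  define b :: "real poly \<Rightarrow> real \<Rightarrow> real" where
    "b p x = (if x > 0 then poly p (inverse x) * exp (- inverse x) else 0)" for p x
  \<comment> \<open>Differentiating p(1/x) exp(-1/x) gives 1/x^2 times p - p' at 1/x times the same
    exponential; \<open>[:0, 0, 1:]\<close> is the factor 1/x^2.\<close>
  define d :: "real poly \<Rightarrow> real poly" where "d p = [:0, 0, 1:] * (p - pderiv p)" for p
  have lim: "((\<lambda>x. poly p (inverse x) * exp (- inverse x)) \<longlongrightarrow> 0) (at_right (0::real))" for p
  proof -
    have "((\<lambda>y. poly p y * exp (- y)) \<longlongrightarrow> 0) at_top"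
    proof -
      have "((\<lambda>y. \<Sum>i\<le>degree p. coeff p i * (y ^ i / exp y)) \<longlongrightarrow> (\<Sum>i\<le>degree p. coeff p i * 0)) at_top"
        by (intro tendsto_intros tendsto_power_div_exp_0)
      then show ?thesis
        by (simp add: poly_altdef sum_distrib_right sum_divide_distrib exp_minus field_simps)
    qed
    then show ?thesis
      by (rule filterlim_compose[OF _ filterlim_inverse_at_top_right])
  qed
  have deriv: "(b p has_real_derivative b (d p) x) (at x)" for p x
  proof -
    consider "x > 0" | "x < 0" | "x = 0" by linarith
    then show ?thesis
    proof cases
      case 1
      have "((\<lambda>x. poly p (inverse x) * exp (- inverse x)) has_real_derivative b (d p) x) (at x)"
        using 1
        by (auto intro!: derivative_eq_intros DERIV_chain'[OF _ poly_DERIV]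
            simp: b_def d_def field_simps power2_eq_square)
      then show ?thesis
        by (rule has_field_derivative_transform_within_open[of _ _ _ "{0<..}"])
          (use 1 in \<open>auto simp: b_def\<close>)
    next
      case 2
      have "((\<lambda>x. 0) has_real_derivative b (d p) x) (at x)" using 2 by (simp add: b_def)
      then show ?thesis
        by (rule has_field_derivative_transform_within_open[of _ _ _ "{..<0}"])
          (use 2 in \<open>auto simp: b_def\<close>)
    next
      case 3
      \<comment> \<open>The value at 0 is 0, and dividing by \<open>h\<close> multiplies the
        polynomial in 1/h by its variable, so the limit \<open>lim\<close> applies to
        \<open>[:0, 1:] * p\<close>.\<close>
      have "((\<lambda>h. b p h / h) \<longlongrightarrow> 0) (at_right 0)"
      proof (rule Lim_transform_eventually[OF lim[of "[:0,1:] * p"]])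
        show "\<forall>\<^sub>F x in at_right 0. poly ([:0, 1:] * p) (inverse x) * exp (- inverse x) = b p x / x"
          unfolding eventually_at_right_field by (auto simp: b_def field_simps intro!: exI[of _ 1])
      qed
      moreover have "((\<lambda>h. b p h / h) \<longlongrightarrow> 0) (at_left 0)"
      proof (rule Lim_transform_eventually[OF tendsto_const])
        show "\<forall>\<^sub>F x in at_left 0. 0 = b p x / x"
          unfolding eventually_at_left_field by (auto simp: b_def intro!: exI[of _ "-1"])
      qed
      ultimately have "((\<lambda>h. b p h / h) \<longlongrightarrow> 0) (at 0)"
        using filterlim_split_at by blast
      then show ?thesis using 3 by (simp add: DERIV_def b_def)
    qed
  qed
  have "C_k_on k UNIV (b p)" for k p
  proof (induction k arbitrary: p)
    case 0
    show ?case
      using deriv DERIV_isCont by (simp add: continuous_on_eq_continuous_at) blast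
  next
    case (Suc k)
    show ?case
    proof (rule C_k_on_SucI)
      show "(b p has_derivative (\<lambda>v. v * b (d p) x)) (at x)" for x
        using deriv[of p x] by (simp add: has_field_derivative_def mult_commute_abs)
      show "C_k_on k UNIV (\<lambda>x. v * b (d p) x)" for v
        using C_k_on_bounded_linear[OF bounded_linear_mult_right _ Suc.IH] by auto
    qed simp
  qed
  then have "smooth_on UNIV (b 1)" by (simp add: smooth_on_def)
  also have "b 1 = (\<lambda>x. if x > 0 then exp (- inverse x) else 0)" by (auto simp: b_def)
  finally show ?thesis .
qed

section \<open>Bump functions and local frames\<close>

locale manifold =
  fixes A :: "('a::{t2_space, second_countable_topology}, 'e::euclidean_space) chart set"
  assumes atlas: "smooth_atlas A"
begin

section \<open>Charts and changes of coordinates\<close>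

lemma chart_at: "chart_at A p \<in> A" "p \<in> dom_chart (chart_at A p)"
proof -
  have "\<exists>c. c \<in> A \<and> p \<in> dom_chart c"
    using atlas unfolding smooth_atlas_def by blast
  then show "chart_at A p \<in> A" "p \<in> dom_chart (chart_at A p)"
    unfolding chart_at_def by (metis (mono_tags, lifting) someI_ex)+
qed

lemma chart:
  assumes "c \<in> A"
  shows open_dom: "open (dom_chart c)"
    and open_coord: "open (coord c ` dom_chart c)"
    and chart_homeomorphism: "homeomorphism (dom_chart c) (coord c ` dom_chart c) (coord c) (inv_chart c)"
  using assms atlas unfolding smooth_atlas_def by auto

lemma inv_chart_coord: "c \<in> A \<Longrightarrow> p \<in> dom_chart c \<Longrightarrow> inv_chart c (coord c p) = p"
  using chart_homeomorphism homeomorphism_apply1 by blast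

lemma open_coord_image:
  assumes "c \<in> A" "open U" "U \<subseteq> dom_chart c"
  shows "open (coord c ` U)"
proof -
  have "openin (top_of_set (coord c ` dom_chart c)) (coord c ` U)"
    using homeomorphism_imp_open_map[OF chart_homeomorphism[OF assms(1)]] assms open_dom
    by (metis open_subset)
  then show ?thesis
    using open_coord[OF assms(1)] openin_open_eq by blast
qed

lemma smooth_transition:
  "c \<in> A \<Longrightarrow> d \<in> A \<Longrightarrow> smooth_on (coord c ` (dom_chart c \<inter> dom_chart d)) (coord d \<circ> inv_chart c)"
  using atlas unfolding smooth_atlas_def by blast

lemma open_overlap: "c \<in> A \<Longrightarrow> d \<in> A \<Longrightarrow> open (coord c ` (dom_chart c \<inter> dom_chart d))"
  by (intro open_coord_image open_Int open_dom) auto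

definition jacobian :: "('a, 'e) chart \<Rightarrow> ('a, 'e) chart \<Rightarrow> 'a \<Rightarrow> 'e \<Rightarrow> 'e" where
  "jacobian c d p = frechet_derivative (coord d \<circ> inv_chart c) (at (coord c p))"

lemma coord_vec_jacobian: "coord_vec A c p = jacobian (chart_at A p) c p"
  by (auto simp: coord_vec_def jacobian_def)

lemma has_derivative_transition:
  assumes "c \<in> A" "d \<in> A" "p \<in> dom_chart c" "p \<in> dom_chart d"
  shows "((coord d \<circ> inv_chart c) has_derivative jacobian c d p) (at (coord c p))"
  unfolding jacobian_def
  by (rule smooth_on_has_derivative[OF smooth_transition[OF assms(1,2)]]) (use assms in auto)

text \<open>Components of tangent vectors refer to a reference chart that jumps from point to point;
  this chain rule eliminates the intermediate chart. The composite through \<open>d\<close> is the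
  direct transition only on the overlap, but the overlap is open, so the derivatives agree.\<close>

lemma jacobian_chain:
  assumes "c \<in> A" "d \<in> A" "e \<in> A" "p \<in> dom_chart c" "p \<in> dom_chart d" "p \<in> dom_chart e"
  shows "jacobian d e p (jacobian c d p v) = jacobian c e p v"
proof -
  have p: "(coord d \<circ> inv_chart c) (coord c p) = coord d p"
    using assms inv_chart_coord by simp
  have "((coord e \<circ> inv_chart d) \<circ> (coord d \<circ> inv_chart c) has_derivative
      jacobian d e p \<circ> jacobian c d p) (at (coord c p))"
    by (rule diff_chain_at[OF has_derivative_transition[OF assms(1,2,4,5)]])
      (simp only: p has_derivative_transition[OF assms(2,3,5,6)])
  then have "((coord e \<circ> inv_chart c) has_derivative jacobian d e p \<circ> jacobian c d p) (at (coord c p))"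
    by (rule has_derivative_transform_within_open[OF _ open_overlap[OF assms(1,2)]])
      (use assms in \<open>auto simp: inv_chart_coord[OF assms(1)] inv_chart_coord[OF assms(2)]\<close>)
  then have "jacobian d e p \<circ> jacobian c d p = jacobian c e p"
    by (rule has_derivative_unique[OF _ has_derivative_transition[OF assms(1,3,4,6)]])
  then show ?thesis by (metis comp_apply)
qed

lemma jacobian_self: "c \<in> A \<Longrightarrow> p \<in> dom_chart c \<Longrightarrow> jacobian c c p v = v"
proof -
  assume c: "c \<in> A" "p \<in> dom_chart c"
  have "((coord c \<circ> inv_chart c) has_derivative (\<lambda>v. v)) (at (coord c p))"
    by (rule has_derivative_transform_within_open[OF has_derivative_ident open_coord[OF c(1)]])
      (use c in \<open>auto simp: inv_chart_coord[OF c(1)]\<close>)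
  then have "(\<lambda>v. v) = jacobian c c p"
    by (rule has_derivative_unique[OF _ has_derivative_transition[OF c(1,1,2,2)]])
  then show ?thesis by metis
qed

lemma linear_coord_vec: "c \<in> A \<Longrightarrow> p \<in> dom_chart c \<Longrightarrow> linear (coord_vec A c p)"
  unfolding coord_vec_jacobian
  by (rule has_derivative_linear[OF has_derivative_transition]) (simp_all add: chart_at)

lemma coord_vec_add:
  "c \<in> A \<Longrightarrow> p \<in> dom_chart c \<Longrightarrow> coord_vec A c p (v + w) = coord_vec A c p v + coord_vec A c p w"
  by (simp add: linear_coord_vec linear_add)

lemma coord_vec_scaleR:
  "c \<in> A \<Longrightarrow> p \<in> dom_chart c \<Longrightarrow> coord_vec A c p (r *\<^sub>R v) = r *\<^sub>R coord_vec A c p v"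
  by (simp add: linear_coord_vec linear_scale)

lemma coord_vec_zero: "c \<in> A \<Longrightarrow> p \<in> dom_chart c \<Longrightarrow> coord_vec A c p 0 = 0"
  by (simp add: linear_coord_vec linear_0)

section \<open>Smooth functions and vector fields\<close>

lemma smooth_fun_const: "smooth_fun A (\<lambda>p. r)"
  by (auto simp: smooth_fun_def o_def smooth_on_const)

lemma smooth_vf_zero: "smooth_vf A (\<lambda>p. 0)"
  unfolding smooth_vf_def
proof
  fix c assume c: "c \<in> A"
  show "smooth_on (coord c ` dom_chart c) (\<lambda>x. coord_vec A c (inv_chart c x) 0)"
    by (subst smooth_on_cong[OF open_coord[OF c], of _ "\<lambda>x. 0"])
      (auto simp: inv_chart_coord[OF c] coord_vec_zero[OF c] smooth_on_const)
qed

lemma smooth_vf_add: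
  assumes "smooth_vf A X" "smooth_vf A Y"
  shows "smooth_vf A (\<lambda>p. X p + Y p)"
  unfolding smooth_vf_def
proof
  fix c assume c: "c \<in> A"
  let ?V = "\<lambda>X x. coord_vec A c (inv_chart c x) (X (inv_chart c x))"
  have "smooth_on (coord c ` dom_chart c) (\<lambda>x. ?V X x + ?V Y x)"
    using assms c open_coord[OF c] by (intro smooth_on_add) (auto simp: smooth_vf_def)
  then show "smooth_on (coord c ` dom_chart c) (?V (\<lambda>p. X p + Y p))"
    by (subst smooth_on_cong[OF open_coord[OF c], of _ "\<lambda>x. ?V X x + ?V Y x"])
      (auto simp: inv_chart_coord[OF c] coord_vec_add[OF c])
qed

lemma smooth_vf_scaleR:
  assumes "smooth_fun A h" "smooth_vf A X"
  shows "smooth_vf A (\<lambda>p. h p *\<^sub>R X p)"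
  unfolding smooth_vf_def
proof
  fix c assume c: "c \<in> A"
  let ?V = "\<lambda>X x. coord_vec A c (inv_chart c x) (X (inv_chart c x))"
  have "smooth_on (coord c ` dom_chart c) (\<lambda>x. (h \<circ> inv_chart c) x *\<^sub>R ?V X x)"
    using assms c open_coord[OF c]
    by (intro smooth_on_scaleR) (simp_all only: smooth_vf_def smooth_fun_def)
  then show "smooth_on (coord c ` dom_chart c) (?V (\<lambda>p. h p *\<^sub>R X p))"
    by (subst smooth_on_cong[OF open_coord[OF c], of _ "\<lambda>x. (h \<circ> inv_chart c) x *\<^sub>R ?V X x"])
      (auto simp: inv_chart_coord[OF c] coord_vec_scaleR[OF c])
qed

lemma smooth_vf_sum:
  "(\<And>i. i \<in> J \<Longrightarrow> smooth_vf A (X i)) \<Longrightarrow> smooth_vf A (\<lambda>p. \<Sum>i\<in>J. X i p)"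
  by (induction J rule: infinite_finite_induct) (simp_all add: smooth_vf_zero smooth_vf_add)

section \<open>Extension by zero and local frames\<close>

lemma smooth_on_extend_zero:
  assumes c: "c \<in> A" and d: "d \<in> A" and K: "closed K" "K \<subseteq> dom_chart c"
    and F: "smooth_on (coord d ` (dom_chart d \<inter> dom_chart c)) F"
    and zero: "\<And>p. p \<in> dom_chart d \<Longrightarrow> p \<notin> K \<Longrightarrow> F (coord d p) = 0"
  shows "smooth_on (coord d ` dom_chart d) F"
proof (rule smooth_on_local)
  fix x assume "x \<in> coord d ` dom_chart d"
  then obtain p where p: "p \<in> dom_chart d" "x = coord d p" by auto
  show "\<exists>U. open U \<and> x \<in> U \<and> smooth_on U F"
  \<comment> \<open>A point of \<open>K\<close> has the overlap of the two charts as a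
    neighbourhood. Any other point has a neighbourhood that avoids \<open>K\<close>, because
    \<open>K\<close> is closed in the whole manifold, and there the map is zero.\<close>
  proof (cases "p \<in> K")
    case True
    then show ?thesis using p K F open_overlap[OF d c] by blast
  next
    case False
    have U: "open (coord d ` (dom_chart d - K))"
      using d K open_dom[OF d] by (intro open_coord_image) auto
    have "smooth_on (coord d ` (dom_chart d - K)) F"
      by (subst smooth_on_cong[OF U, of _ "\<lambda>x. 0"]) (auto simp: zero smooth_on_const)
    then show ?thesis using U p False by blast
  qed
qed

lemma smooth_bump:
  fixes x0 :: "'v::euclidean_space"
  shows "smooth_on UNIV (\<lambda>x. let y = e\<^sup>2 - (x - x0) \<bullet> (x - x0) in
    if y > 0 then exp (- inverse y) else 0)"
proof -
  have sub: "smooth_on UNIV (\<lambda>x. x + (- x0))"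
    by (intro smooth_on_add smooth_on_id smooth_on_const) auto
  have inner: "smooth_on UNIV (\<lambda>x. (x + (- x0)) \<bullet> (x + (- x0)))"
    using sub unfolding smooth_on_def
    by (intro allI C_k_on_bounded_bilinear[OF bounded_bilinear_inner open_UNIV]) blast+
  have "smooth_on UNIV (\<lambda>x. e\<^sup>2 + (-1) * ((x + (- x0)) \<bullet> (x + (- x0))))"
    by (intro smooth_on_add smooth_on_mult smooth_on_const inner) auto
  then have "smooth_on UNIV (\<lambda>x. e\<^sup>2 - (x - x0) \<bullet> (x - x0))" by simp
  from smooth_on_compose[OF open_UNIV this smooth_on_exp_bump]
  show ?thesis by (simp add: Let_def)
qed

text \<open>The coordinate fields of a chart live on its domain only. Multiplied by a bump function
  they extend by zero to global fields, at the price of the factor \<phi> in the expansion. As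
  \<open>\<phi> p\<close> is nonzero, this factor can be divided out at \<open>p\<close>.\<close>

lemma local_frame:
  assumes c: "c \<in> A" and p: "p \<in> dom_chart c"
  obtains \<phi> Y K where "smooth_fun A \<phi>" "\<phi> p \<noteq> 0" "\<And>b::'e. smooth_vf A (Y b)"
    "closed K" "K \<subseteq> dom_chart c" "\<And>p. p \<notin> K \<Longrightarrow> \<phi> p = 0"
    "\<And>p v. p \<in> dom_chart c \<Longrightarrow> \<phi> p *\<^sub>R v = (\<Sum>b\<in>Basis. (coord_vec A c p v \<bullet> b) *\<^sub>R Y b p)"
proof -
  obtain e where e: "e > 0" "cball (coord c p) e \<subseteq> coord c ` dom_chart c"
    using open_coord[OF c] p open_contains_cball by blast
  \<comment> \<open>This is positive exactly on the open ball of radius \<open>e\<close>, whose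
    closure lies in the image of the chart.\<close>
  define B where "B x = (let y = e\<^sup>2 - (x - coord c p) \<bullet> (x - coord c p) in
      if y > 0 then exp (- inverse y) else 0)" for x
  have B: "smooth_on UNIV B" unfolding B_def by (rule smooth_bump)
  have B0: "B x = 0" if "x \<notin> cball (coord c p) e" for x
  proof -
    have "e < norm (x - coord c p)" using that by (simp add: dist_norm norm_minus_commute)
    then have "e\<^sup>2 < (norm (x - coord c p))\<^sup>2" using e by (intro power_strict_mono) auto
    then show ?thesis by (simp add: B_def power2_norm_eq_inner)
  qed
  define K where "K = inv_chart c ` cball (coord c p) e"
  have "continuous_on (cball (coord c p) e) (inv_chart c)"
    by (rule continuous_on_subset[OF homeomorphism_cont2[OF chart_homeomorphism[OF c]] e(2)])
  \<comment> \<open>A compact set is closed here because the manifold is Hausdorff; being closed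
    relative to the chart domain would not suffice for extension by zero.\<close>
  then have "closed K"
    unfolding K_def by (intro compact_imp_closed compact_continuous_image compact_cball)
  moreover have "K \<subseteq> dom_chart c"
  proof
    fix r assume "r \<in> K"
    then obtain x where x: "r = inv_chart c x" "x \<in> coord c ` dom_chart c"
      using e(2) unfolding K_def by blast
    then show "r \<in> dom_chart c" using inv_chart_coord[OF c] by auto
  qed
  ultimately have K: "closed K" "K \<subseteq> dom_chart c" by auto
  define \<phi> where "\<phi> p = (if p \<in> dom_chart c then B (coord c p) else 0)" for p
  have \<phi>0: "\<phi> r = 0" if "r \<notin> K" for r
    using that B0[of "coord c r"] inv_chart_coord[OF c, of r] unfolding K_def \<phi>_def
    by (metis imageI)
  define Y where "Y b p = \<phi> p *\<^sub>R jacobian c (chart_at A p) p b" for b p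
  have \<phi>_overlap: "smooth_on (coord d ` (dom_chart d \<inter> dom_chart c)) (\<phi> \<circ> inv_chart d)"
    if d: "d \<in> A" for d
  proof (subst smooth_on_cong[OF open_overlap[OF d c]])
    show "(\<phi> \<circ> inv_chart d) x = B ((coord c \<circ> inv_chart d) x)"
      if "x \<in> coord d ` (dom_chart d \<inter> dom_chart c)" for x
      using that inv_chart_coord[OF d] by (auto simp: \<phi>_def)
    show "smooth_on (coord d ` (dom_chart d \<inter> dom_chart c)) (\<lambda>x. B ((coord c \<circ> inv_chart d) x))"
      by (rule smooth_on_compose[OF open_overlap[OF d c] smooth_transition[OF d c] B]) simp
  qed
  have \<phi>: "smooth_fun A \<phi>"
    unfolding smooth_fun_def
  proof
    fix d assume d: "d \<in> A"
    show "smooth_on (coord d ` dom_chart d) (\<phi> \<circ> inv_chart d)"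
      by (rule smooth_on_extend_zero[OF c d K \<phi>_overlap[OF d]]) (simp add: inv_chart_coord[OF d] \<phi>0)
  qed
  have \<phi>p: "\<phi> p \<noteq> 0" using p e by (simp add: \<phi>_def B_def)
  have Y: "smooth_vf A (Y b)" for b
    unfolding smooth_vf_def
  proof
    fix d assume d: "d \<in> A"
    let ?F = "\<lambda>x. coord_vec A d (inv_chart d x) (Y b (inv_chart d x))"
    \<comment> \<open>On the overlap the reference chart drops out by \<open>jacobian_chain\<close>,
      leaving the derivative of a fixed change of coordinates in the fixed direction
      \<open>b\<close>.\<close>
    let ?G = "\<lambda>x. (\<phi> \<circ> inv_chart d) x *\<^sub>R
        frechet_derivative (coord d \<circ> inv_chart c) (at ((coord c \<circ> inv_chart d) x)) b"
    have "?F x = ?G x" if "x \<in> coord d ` (dom_chart d \<inter> dom_chart c)" for x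
    proof -
      obtain r where r: "r \<in> dom_chart d" "r \<in> dom_chart c" "x = coord d r" using \<open>x \<in> _\<close> by auto
      have "?F x = \<phi> r *\<^sub>R jacobian (chart_at A r) d r (jacobian c (chart_at A r) r b)"
        using r d by (simp add: inv_chart_coord Y_def coord_vec_scaleR) (simp add: coord_vec_jacobian)
      also have "\<dots> = \<phi> r *\<^sub>R jacobian c d r b"
        using r c d chart_at by (subst jacobian_chain) auto
      finally show ?thesis using r d by (simp add: inv_chart_coord jacobian_def)
    qed
    moreover have "smooth_on (coord d ` (dom_chart d \<inter> dom_chart c)) ?G"
      by (intro smooth_on_scaleR open_overlap d c \<phi>_overlap
          smooth_on_compose[OF open_overlap[OF d c] smooth_transition[OF d c]
            smooth_on_frechet_derivative[OF smooth_transition[OF c d]]])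
        (auto simp: inv_chart_coord[OF d])
    ultimately have "smooth_on (coord d ` (dom_chart d \<inter> dom_chart c)) ?F"
      using smooth_on_cong[OF open_overlap[OF d c], of ?F ?G] by blast
    then show "smooth_on (coord d ` dom_chart d) ?F"
      by (rule smooth_on_extend_zero[OF c d K])
        (simp add: d inv_chart_coord Y_def \<phi>0 coord_vec_zero)
  qed
  have "\<phi> p *\<^sub>R v = (\<Sum>b\<in>Basis. (coord_vec A c p v \<bullet> b) *\<^sub>R Y b p)"
    if p: "p \<in> dom_chart c" for p v
  proof -
    have "linear (jacobian c (chart_at A p) p)"
      by (rule has_derivative_linear[OF has_derivative_transition]) (simp_all add: c p chart_at)
    then interpret linear "jacobian c (chart_at A p) p" .
    have "jacobian c (chart_at A p) p (coord_vec A c p v) = v"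
      using c p chart_at by (simp add: coord_vec_jacobian jacobian_chain jacobian_self)
    moreover have "jacobian c (chart_at A p) p w =
        (\<Sum>b\<in>Basis. (w \<bullet> b) *\<^sub>R jacobian c (chart_at A p) p b)" for w
      by (subst euclidean_representation[symmetric, of w]) (simp only: sum scale)
    ultimately have "v = (\<Sum>b\<in>Basis. (coord_vec A c p v \<bullet> b) *\<^sub>R jacobian c (chart_at A p) p b)"
      by metis
    then have "\<phi> p *\<^sub>R v = \<phi> p *\<^sub>R (\<Sum>b\<in>Basis. (coord_vec A c p v \<bullet> b) *\<^sub>R jacobian c (chart_at A p) p b)"
      by simp
    then show ?thesis by (simp add: Y_def scaleR_sum_right mult.commute)
  qed
  from that[OF \<phi> \<phi>p Y K \<phi>0 this] show ?thesis .
qed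

text \<open>The operator \<open>nabla\<close> takes global fields, so the velocity at a given time
  has to be extended before it can serve as a direction. A combination of the frame with constant
  coefficients, divided by the value of the bump function at \<open>p\<close>, does it.\<close>

lemma smooth_vf_extension:
  obtains X where "smooth_vf A X" "X p = v"
proof -
  let ?c = "chart_at A p"
  obtain \<phi> Y where \<phi>: "\<phi> p \<noteq> 0" and Y: "\<And>b. smooth_vf A (Y b)"
    and eq: "\<And>p v. p \<in> dom_chart ?c \<Longrightarrow> \<phi> p *\<^sub>R v = (\<Sum>b\<in>Basis. (coord_vec A ?c p v \<bullet> b) *\<^sub>R Y b p)"
    by (rule local_frame[OF chart_at]) (rule that)
  let ?X = "\<lambda>x. (inverse (\<phi> p)) *\<^sub>R (\<Sum>b\<in>Basis. (coord_vec A ?c p v \<bullet> b) *\<^sub>R Y b x)"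
  have "smooth_vf A ?X"
    by (intro smooth_vf_scaleR smooth_vf_sum smooth_fun_const Y)
  moreover have "?X p = v"
    using \<phi> by (simp flip: eq[OF chart_at(2), of v])
  ultimately show ?thesis using that by blast
qed

end

section \<open>Smooth functions and fields along a curve\<close>

locale manifold_curve = manifold A
  for A :: "('a::{t2_space, second_countable_topology}, 'e::euclidean_space) chart set" +
  fixes I :: "real set" and \<gamma> :: "real \<Rightarrow> 'a"
  assumes curve: "smooth_curve A I \<gamma>"
begin

lemma open_I: "open I"
  using curve by (simp add: smooth_curve_def)

lemma open_vimage: "open U \<Longrightarrow> open (I \<inter> \<gamma> -` U)"
  using curve continuous_open_preimage unfolding smooth_curve_def by blast

lemma open_preimage_dom: "c \<in> A \<Longrightarrow> open (I \<inter> \<gamma> -` dom_chart c)"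
  by (intro open_vimage open_dom)

lemma smooth_coord_curve: "c \<in> A \<Longrightarrow> smooth_on (I \<inter> \<gamma> -` dom_chart c) (coord c \<circ> \<gamma>)"
  using curve unfolding smooth_curve_def by blast

lemma smooth_fun_along:
  assumes "smooth_fun A h"
  shows "smooth_on I (\<lambda>u. h (\<gamma> u))"
proof (rule smooth_on_local)
  fix t assume t: "t \<in> I"
  let ?c = "chart_at A (\<gamma> t)" and ?U = "I \<inter> \<gamma> -` dom_chart (chart_at A (\<gamma> t))"
  note c = chart_at(1)[of "\<gamma> t"]
  have "smooth_on (coord ?c ` dom_chart ?c) (h \<circ> inv_chart ?c)"
    using assms c unfolding smooth_fun_def by blast
  then have "smooth_on ?U (\<lambda>u. (h \<circ> inv_chart ?c) ((coord ?c \<circ> \<gamma>) u))"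
    by (rule smooth_on_compose[OF open_preimage_dom[OF c] smooth_coord_curve[OF c]]) auto
  then have "smooth_on ?U (\<lambda>u. h (\<gamma> u))"
    by (subst smooth_on_cong[OF open_preimage_dom[OF c], of _ "\<lambda>u. (h \<circ> inv_chart ?c) ((coord ?c \<circ> \<gamma>) u)"])
      (auto simp: inv_chart_coord[OF c])
  then show "\<exists>U. open U \<and> t \<in> U \<and> smooth_on U (\<lambda>u. h (\<gamma> u))"
    using t chart_at(2) open_preimage_dom[OF c] by blast
qed

lemma smooth_vf_along:
  assumes "smooth_vf A Y"
  shows "smooth_field_along A I \<gamma> (\<lambda>u. Y (\<gamma> u))"
  unfolding smooth_field_along_def
proof
  fix c assume c: "c \<in> A"
  let ?V = "\<lambda>x. coord_vec A c (inv_chart c x) (Y (inv_chart c x))"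
  have "smooth_on (coord c ` dom_chart c) ?V"
    using assms c unfolding smooth_vf_def by blast
  then have "smooth_on (I \<inter> \<gamma> -` dom_chart c) (\<lambda>u. ?V ((coord c \<circ> \<gamma>) u))"
    by (rule smooth_on_compose[OF open_preimage_dom[OF c] smooth_coord_curve[OF c]]) auto
  then show "smooth_on (I \<inter> \<gamma> -` dom_chart c) (\<lambda>u. coord_vec A c (\<gamma> u) (Y (\<gamma> u)))"
    by (subst smooth_on_cong[OF open_preimage_dom[OF c], of _ "\<lambda>u. ?V ((coord c \<circ> \<gamma>) u)"])
      (auto simp: inv_chart_coord[OF c])
qed

lemma smooth_field_along_cong:
  assumes "\<And>u. u \<in> I \<Longrightarrow> V u = W u" "smooth_field_along A I \<gamma> V"
  shows "smooth_field_along A I \<gamma> W"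
  unfolding smooth_field_along_def
proof
  fix c assume c: "c \<in> A"
  show "smooth_on (I \<inter> \<gamma> -` dom_chart c) (\<lambda>t. coord_vec A c (\<gamma> t) (W t))"
    by (subst smooth_on_cong[OF open_preimage_dom[OF c], of _ "\<lambda>t. coord_vec A c (\<gamma> t) (V t)"])
      (use assms c in \<open>auto simp: smooth_field_along_def\<close>)
qed

lemma smooth_field_along_add:
  assumes "smooth_field_along A I \<gamma> V" "smooth_field_along A I \<gamma> W"
  shows "smooth_field_along A I \<gamma> (\<lambda>u. V u + W u)"
  unfolding smooth_field_along_def
proof
  fix c assume c: "c \<in> A"
  have "smooth_on (I \<inter> \<gamma> -` dom_chart c) (\<lambda>t. coord_vec A c (\<gamma> t) (V t) + coord_vec A c (\<gamma> t) (W t))"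
    using assms c by (intro smooth_on_add open_preimage_dom) (auto simp: smooth_field_along_def)
  then show "smooth_on (I \<inter> \<gamma> -` dom_chart c) (\<lambda>t. coord_vec A c (\<gamma> t) (V t + W t))"
    by (subst smooth_on_cong[OF open_preimage_dom[OF c], of _
          "\<lambda>t. coord_vec A c (\<gamma> t) (V t) + coord_vec A c (\<gamma> t) (W t)"])
      (auto simp: coord_vec_add[OF c])
qed

lemma smooth_field_along_scaleR:
  assumes "smooth_on I h" "smooth_field_along A I \<gamma> V"
  shows "smooth_field_along A I \<gamma> (\<lambda>u. h u *\<^sub>R V u)"
  unfolding smooth_field_along_def
proof
  fix c assume c: "c \<in> A"
  have "smooth_on (I \<inter> \<gamma> -` dom_chart c) (\<lambda>t. h t *\<^sub>R coord_vec A c (\<gamma> t) (V t))"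
    using assms c smooth_on_subset[OF assms(1)]
    by (intro smooth_on_scaleR open_preimage_dom) (auto simp: smooth_field_along_def)
  then show "smooth_on (I \<inter> \<gamma> -` dom_chart c) (\<lambda>t. coord_vec A c (\<gamma> t) (h t *\<^sub>R V t))"
    by (subst smooth_on_cong[OF open_preimage_dom[OF c], of _ "\<lambda>t. h t *\<^sub>R coord_vec A c (\<gamma> t) (V t)"])
      (auto simp: coord_vec_scaleR[OF c])
qed

lemma smooth_field_along_zero: "smooth_field_along A I \<gamma> (\<lambda>u. 0)"
  using smooth_vf_along[OF smooth_vf_zero] .

lemma smooth_field_along_sum:
  "(\<And>i. i \<in> J \<Longrightarrow> smooth_field_along A I \<gamma> (V i)) \<Longrightarrow>
    smooth_field_along A I \<gamma> (\<lambda>u. \<Sum>i\<in>J. V i u)"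
  by (induction J rule: infinite_finite_induct)
    (simp_all add: smooth_field_along_zero smooth_field_along_add)

text \<open>The factor \<open>\<rho>\<close> makes the expansion of \<open>V\<close> in a local frame global, so that it can be fed to
  an operator \<open>D\<close> that is only given on fields along all of \<open>I\<close>; by the product rule \<open>\<rho>\<close> cancels at
  \<open>t\<close> in every identity between first order operators.\<close>

lemma frame_expansion:
  assumes V: "smooth_field_along A I \<gamma> V" and t: "t \<in> I"
  obtains \<rho> h Y where "smooth_on I \<rho>" "\<rho> t \<noteq> 0" "\<And>b::'e. smooth_on I (h b)" "\<And>b. smooth_vf A (Y b)"
    "\<And>u. u \<in> I \<Longrightarrow> \<rho> u *\<^sub>R V u = (\<Sum>b\<in>Basis. h b u *\<^sub>R Y b (\<gamma> u))"
proof -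
  let ?c = "chart_at A (\<gamma> t)"
  note c = chart_at(1)[of "\<gamma> t"]
  obtain \<phi> Y K where \<phi>: "smooth_fun A \<phi>" "\<phi> (\<gamma> t) \<noteq> 0" and Y: "\<And>b. smooth_vf A (Y b)"
    and K: "closed K" "K \<subseteq> dom_chart ?c" and \<phi>0: "\<And>p. p \<notin> K \<Longrightarrow> \<phi> p = 0"
    and eq: "\<And>p v. p \<in> dom_chart ?c \<Longrightarrow> \<phi> p *\<^sub>R v = (\<Sum>b\<in>Basis. (coord_vec A ?c p v \<bullet> b) *\<^sub>R Y b p)"
    by (rule local_frame[OF chart_at]) (rule that)
  \<comment> \<open>The components of \<open>V\<close> in the fixed chart are smooth only while the
    curve stays in its domain, so \<open>h\<close> carries a factor \<phi>. Another one comes from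
    the frame, and \<rho> is therefore the square of \<phi> along the curve.\<close>
  define h where "h b u = \<phi> (\<gamma> u) * (coord_vec A ?c (\<gamma> u) (V u) \<bullet> b)" for b u
  have \<phi>\<gamma>: "smooth_on I (\<lambda>u. \<phi> (\<gamma> u))" using \<phi> smooth_fun_along by blast
  have h: "smooth_on I (h b)" for b
  proof (rule smooth_on_local)
    fix u assume u: "u \<in> I"
    show "\<exists>U. open U \<and> u \<in> U \<and> smooth_on U (h b)"
    proof (cases "\<gamma> u \<in> K")
      case True
      have "smooth_on (I \<inter> \<gamma> -` dom_chart ?c) (h b)"
        unfolding h_def
        by (intro smooth_on_mult smooth_on_bounded_linear[OF bounded_linear_inner_left]
            open_preimage_dom c smooth_on_subset[OF \<phi>\<gamma>])
          (use V c in \<open>auto simp: smooth_field_along_def\<close>)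
      then show ?thesis using True u K open_preimage_dom[OF c] by blast
    next
      case False
      have U: "open (I \<inter> \<gamma> -` (- K))" using K by (intro open_vimage) auto
      have "smooth_on (I \<inter> \<gamma> -` (- K)) (h b)"
        by (subst smooth_on_cong[OF U, of _ "\<lambda>u. 0"]) (auto simp: h_def \<phi>0 smooth_on_const)
      then show ?thesis using U u False by blast
    qed
  qed
  have "(\<phi> (\<gamma> u) * \<phi> (\<gamma> u)) *\<^sub>R V u = (\<Sum>b\<in>Basis. h b u *\<^sub>R Y b (\<gamma> u))" for u
  proof (cases "\<gamma> u \<in> dom_chart ?c")
    case True
    have "(\<phi> (\<gamma> u) * \<phi> (\<gamma> u)) *\<^sub>R V u = \<phi> (\<gamma> u) *\<^sub>R (\<phi> (\<gamma> u) *\<^sub>R V u)" by simp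
    also have "\<dots> = (\<Sum>b\<in>Basis. h b u *\<^sub>R Y b (\<gamma> u))"
      by (subst eq[OF True]) (simp add: h_def scaleR_sum_right)
    finally show ?thesis .
  next
    case False
    then have "\<phi> (\<gamma> u) = 0" using K \<phi>0[of "\<gamma> u"] by blast
    then show ?thesis by (simp add: h_def)
  qed
  then show ?thesis
    by (intro that[of "\<lambda>u. \<phi> (\<gamma> u) * \<phi> (\<gamma> u)" h Y] h Y smooth_on_mult open_I \<phi>\<gamma>)
      (simp_all add: \<phi>(2))
qed

end

section \<open>Covariant derivatives along curves\<close>

lemma tangent_app_const: "tangent_app A p v (\<lambda>q. r) = 0"
  by (simp add: tangent_app_def o_def frechet_derivative_const)

locale covariant_curve = manifold_curve A I \<gamma>
  for A :: "('a::{t2_space, second_countable_topology}, 'e::euclidean_space) chart set" and I \<gamma> +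
  fixes nabla :: "('a \<Rightarrow> 'e) \<Rightarrow> ('a \<Rightarrow> 'e) \<Rightarrow> 'a \<Rightarrow> 'e" and D :: "(real \<Rightarrow> 'e) \<Rightarrow> real \<Rightarrow> 'e"
  assumes connection: "affine_connection A nabla" and cov_deriv: "cov_deriv_along A nabla I \<gamma> D"
begin

lemma D_add:
  "smooth_field_along A I \<gamma> V \<Longrightarrow> smooth_field_along A I \<gamma> W \<Longrightarrow> t \<in> I \<Longrightarrow>
    D (\<lambda>u. V u + W u) t = D V t + D W t"
  using cov_deriv unfolding cov_deriv_along_def by blast

lemma D_scaleR:
  "smooth_on I h \<Longrightarrow> smooth_field_along A I \<gamma> V \<Longrightarrow> t \<in> I \<Longrightarrow>
    D (\<lambda>u. h u *\<^sub>R V u) t = deriv h t *\<^sub>R V t + h t *\<^sub>R D V t"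
  using cov_deriv unfolding cov_deriv_along_def by blast

lemma D_vf:
  "smooth_vf A X \<Longrightarrow> smooth_vf A Y \<Longrightarrow> t \<in> I \<Longrightarrow> X (\<gamma> t) = velocity A \<gamma> t \<Longrightarrow>
    D (\<lambda>u. Y (\<gamma> u)) t = nabla X Y (\<gamma> t)"
  using cov_deriv unfolding cov_deriv_along_def by blast

lemma D_zero: "t \<in> I \<Longrightarrow> D (\<lambda>u. 0) t = 0"
  using D_scaleR[OF smooth_on_const[of I 0] smooth_field_along_zero] by simp

lemma D_const_scaleR:
  "smooth_field_along A I \<gamma> V \<Longrightarrow> t \<in> I \<Longrightarrow> D (\<lambda>u. r *\<^sub>R V u) t = r *\<^sub>R D V t"
  using D_scaleR[OF smooth_on_const[of I r]] by simp

text \<open>A field that vanishes on \<open>I\<close> is its own multiple by the indicator of the complement of \<open>I\<close>.\<close>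

lemma D_cong:
  assumes V: "smooth_field_along A I \<gamma> V" and eq: "\<And>u. u \<in> I \<Longrightarrow> V u = W u" and t: "t \<in> I"
  shows "D V t = D W t"
proof -
  define Z where "Z u = W u + (-1) *\<^sub>R V u" for u
  define h :: "real \<Rightarrow> real" where "h u = (if u \<in> I then 0 else 1)" for u
  have W: "smooth_field_along A I \<gamma> W" using smooth_field_along_cong[OF eq V] .
  have Z: "smooth_field_along A I \<gamma> Z"
    unfolding Z_def by (intro smooth_field_along_add W smooth_field_along_scaleR smooth_on_const V)
  have h: "smooth_on I h"
    by (subst smooth_on_cong[OF open_I, of _ "\<lambda>u. 0"]) (auto simp: h_def smooth_on_const)
  have "(\<lambda>u. h u *\<^sub>R Z u) = Z" by (auto simp: h_def Z_def eq)
  then have "D Z t = deriv h t *\<^sub>R Z t + h t *\<^sub>R D Z t"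
    using D_scaleR[OF h Z t] by simp
  then have "D Z t = 0" using t eq by (simp add: h_def Z_def)
  then have "D (\<lambda>u. V u + Z u) t = D V t" using D_add[OF V Z t] by simp
  then show ?thesis by (simp add: Z_def)
qed

lemma D_sum:
  assumes "\<And>i. i \<in> J \<Longrightarrow> smooth_field_along A I \<gamma> (V i)" and t: "t \<in> I"
  shows "D (\<lambda>u. \<Sum>i\<in>J. V i u) t = (\<Sum>i\<in>J. D (V i) t)"
  using assms(1)
proof (induction J rule: infinite_finite_induct)
  case (insert i J)
  then show ?case
    using D_add[OF _ smooth_field_along_sum t, of "V i" J V] by simp
qed (simp_all add: D_zero t)

text \<open>The defining conditions link \<open>D\<close> to \<open>nabla\<close> only on
  restrictions of global fields. Together with \<open>frame_expansion\<close>, this formula gives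
  \<open>D\<close> on every smooth field along \<gamma>.\<close>

lemma D_combination:
  assumes h: "\<And>i. i \<in> J \<Longrightarrow> smooth_on I (h i)" and Y: "\<And>i. i \<in> J \<Longrightarrow> smooth_vf A (Y i)"
    and X: "smooth_vf A X" "X (\<gamma> t) = velocity A \<gamma> t" and t: "t \<in> I"
  shows "D (\<lambda>u. \<Sum>i\<in>J. h i u *\<^sub>R Y i (\<gamma> u)) t =
    (\<Sum>i\<in>J. deriv (h i) t *\<^sub>R Y i (\<gamma> t) + h i t *\<^sub>R nabla X (Y i) (\<gamma> t))"
proof -
  have "D (\<lambda>u. \<Sum>i\<in>J. h i u *\<^sub>R Y i (\<gamma> u)) t = (\<Sum>i\<in>J. D (\<lambda>u. h i u *\<^sub>R Y i (\<gamma> u)) t)"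
    by (intro D_sum smooth_field_along_scaleR smooth_vf_along h Y t)
  also have "\<dots> = (\<Sum>i\<in>J. deriv (h i) t *\<^sub>R Y i (\<gamma> t) + h i t *\<^sub>R nabla X (Y i) (\<gamma> t))"
    by (intro sum.cong refl) (simp add: D_scaleR h Y smooth_vf_along t D_vf[OF X(1) Y t X(2)])
  finally show ?thesis .
qed

text \<open>The chain rule for \<open>h \<circ> \<gamma>\<close>, read off from the product rules for \<open>h X\<close>.\<close>

lemma deriv_along:
  assumes h: "smooth_fun A h" and X: "smooth_vf A X" "X (\<gamma> t) = velocity A \<gamma> t"
    and t: "t \<in> I" and nz: "velocity A \<gamma> t \<noteq> 0"
  shows "deriv (\<lambda>u. h (\<gamma> u)) t = vf_app A X h (\<gamma> t)"
proof -
  have "D (\<lambda>u. h (\<gamma> u) *\<^sub>R X (\<gamma> u)) t = nabla X (\<lambda>q. h q *\<^sub>R X q) (\<gamma> t)"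
    using D_vf[OF X(1) smooth_vf_scaleR[OF h X(1)] t X(2)] .
  also have "\<dots> = vf_app A X h (\<gamma> t) *\<^sub>R X (\<gamma> t) + h (\<gamma> t) *\<^sub>R nabla X X (\<gamma> t)"
    using connection h X unfolding affine_connection_def by blast
  finally have "deriv (\<lambda>u. h (\<gamma> u)) t *\<^sub>R X (\<gamma> t) = vf_app A X h (\<gamma> t) *\<^sub>R X (\<gamma> t)"
    using D_scaleR[OF smooth_fun_along[OF h] smooth_vf_along[OF X(1)] t] D_vf[OF X(1,1) t X(2)] by simp
  then show ?thesis using nz X by simp
qed

text \<open>Expanding \<rho> times \<open>V\<close> in global fields reduces the claim to
  \<open>cov\<close>, field by field. The terms containing the derivative of \<rho> agree on both
  sides and the factor \<rho> cancels; linearity of \<open>L\<close> carries its values on the frame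
  over to \<open>V\<close>.\<close>

lemma D_tensor:
  assumes f: "tensor_field_1_1 A f" and V: "smooth_field_along A I \<gamma> V"
    and fV: "smooth_field_along A I \<gamma> (\<lambda>u. f (\<gamma> u) (V u))"
    and X: "smooth_vf A X" "X (\<gamma> t) = velocity A \<gamma> t" and t: "t \<in> I" and L: "linear L"
    and cov: "\<And>Y. smooth_vf A Y \<Longrightarrow> cov_deriv_tensor nabla f X Y (\<gamma> t) = L (Y (\<gamma> t))"
  shows "D (\<lambda>u. f (\<gamma> u) (V u)) t = L (V t) + f (\<gamma> t) (D V t)"
proof -
  obtain \<rho> h Y where \<rho>: "smooth_on I \<rho>" "\<rho> t \<noteq> 0" and h: "\<And>b. smooth_on I (h b)"
    and Y: "\<And>b::'e. smooth_vf A (Y b)"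
    and eq: "\<And>u. u \<in> I \<Longrightarrow> \<rho> u *\<^sub>R V u = (\<Sum>b\<in>Basis. h b u *\<^sub>R Y b (\<gamma> u))"
    by (rule frame_expansion[OF V t]) (rule that)
  have lin: "linear (f p)" for p using f by (simp add: tensor_field_1_1_def)
  interpret F: linear "f (\<gamma> t)" by (rule lin)
  interpret L: linear L by (rule L)
  have fY: "smooth_vf A (\<lambda>q. f q (Y b q))" for b using f Y by (simp add: tensor_field_1_1_def)
  have feq: "\<rho> u *\<^sub>R f (\<gamma> u) (V u) = (\<Sum>b\<in>Basis. h b u *\<^sub>R f (\<gamma> u) (Y b (\<gamma> u)))" if "u \<in> I" for u
  proof -
    have "\<rho> u *\<^sub>R f (\<gamma> u) (V u) = f (\<gamma> u) (\<rho> u *\<^sub>R V u)" by (simp add: linear_scale[OF lin])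
    then show ?thesis by (simp add: eq that linear_sum[OF lin] linear_scale[OF lin])
  qed
  have D1: "deriv \<rho> t *\<^sub>R V t + \<rho> t *\<^sub>R D V t =
      (\<Sum>b\<in>Basis. deriv (h b) t *\<^sub>R Y b (\<gamma> t) + h b t *\<^sub>R nabla X (Y b) (\<gamma> t))"
    using D_cong[OF smooth_field_along_scaleR[OF \<rho>(1) V] eq t] D_scaleR[OF \<rho>(1) V t]
      D_combination[OF h Y X t] by simp
  have "deriv \<rho> t *\<^sub>R f (\<gamma> t) (V t) + \<rho> t *\<^sub>R D (\<lambda>u. f (\<gamma> u) (V u)) t =
      (\<Sum>b\<in>Basis. deriv (h b) t *\<^sub>R f (\<gamma> t) (Y b (\<gamma> t)) + h b t *\<^sub>R nabla X (\<lambda>q. f q (Y b q)) (\<gamma> t))"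
    using D_cong[OF smooth_field_along_scaleR[OF \<rho>(1) fV] feq t] D_scaleR[OF \<rho>(1) fV t]
      D_combination[OF h fY X t] by simp
  also have "\<dots> = (\<Sum>b\<in>Basis. f (\<gamma> t) (deriv (h b) t *\<^sub>R Y b (\<gamma> t) + h b t *\<^sub>R nabla X (Y b) (\<gamma> t))
      + L (h b t *\<^sub>R Y b (\<gamma> t)))"
  proof (intro sum.cong refl)
    fix b
    have "nabla X (\<lambda>q. f q (Y b q)) (\<gamma> t) = L (Y b (\<gamma> t)) + f (\<gamma> t) (nabla X (Y b) (\<gamma> t))"
      using cov[OF Y[of b]] by (simp add: cov_deriv_tensor_def algebra_simps)
    then show "deriv (h b) t *\<^sub>R f (\<gamma> t) (Y b (\<gamma> t)) + h b t *\<^sub>R nabla X (\<lambda>q. f q (Y b q)) (\<gamma> t) =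
        f (\<gamma> t) (deriv (h b) t *\<^sub>R Y b (\<gamma> t) + h b t *\<^sub>R nabla X (Y b) (\<gamma> t)) + L (h b t *\<^sub>R Y b (\<gamma> t))"
      by (simp add: F.add F.scale L.scale algebra_simps)
  qed
  also have "\<dots> = f (\<gamma> t) (deriv \<rho> t *\<^sub>R V t + \<rho> t *\<^sub>R D V t) + L (\<rho> t *\<^sub>R V t)"
    unfolding D1 eq[OF t] F.sum L.sum by (simp only: sum.distrib)
  also have "\<dots> = deriv \<rho> t *\<^sub>R f (\<gamma> t) (V t) + \<rho> t *\<^sub>R (L (V t) + f (\<gamma> t) (D V t))"
    by (simp add: F.add F.scale L.scale algebra_simps)
  finally show ?thesis using \<rho>(2) by simp
qed

text \<open>The metric condition, known for global fields, is transported to \<open>V\<close>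
  through a frame. The inner product of \<open>V\<close> and \<open>Z\<close> vanishes on
  \<open>I\<close>, so its derivative is available without a separate smoothness argument.\<close>

lemma D_orthogonal:
  assumes g: "riemannian_metric A g"
    and compat: "\<And>X Y Z p. smooth_vf A X \<Longrightarrow> smooth_vf A Y \<Longrightarrow> smooth_vf A Z \<Longrightarrow>
        vf_app A X (\<lambda>q. g q (Y q) (Z q)) p = g p (nabla X Y p) (Z p) + g p (Y p) (nabla X Z p)"
    and V: "smooth_field_along A I \<gamma> V" and Z: "smooth_vf A Z"
    and orth: "\<And>u. u \<in> I \<Longrightarrow> g (\<gamma> u) (V u) (Z (\<gamma> u)) = 0"
    and X: "smooth_vf A X" "X (\<gamma> t) = velocity A \<gamma> t" and t: "t \<in> I" and nz: "velocity A \<gamma> t \<noteq> 0"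
  shows "g (\<gamma> t) (D V t) (Z (\<gamma> t)) + g (\<gamma> t) (V t) (nabla X Z (\<gamma> t)) = 0"
proof -
  obtain \<rho> h Y where \<rho>: "smooth_on I \<rho>" "\<rho> t \<noteq> 0" and h: "\<And>b. smooth_on I (h b)"
    and Y: "\<And>b::'e. smooth_vf A (Y b)"
    and eq: "\<And>u. u \<in> I \<Longrightarrow> \<rho> u *\<^sub>R V u = (\<Sum>b\<in>Basis. h b u *\<^sub>R Y b (\<gamma> u))"
    by (rule frame_expansion[OF V t]) (rule that)
  have lin: "linear (\<lambda>v. g p v w)" for p w
    using g by (auto simp: riemannian_metric_def bilinear_def)
  note lin_simps = linear_add[OF lin] linear_scale[OF lin] linear_sum[OF lin]
  define k where "k b u = g (\<gamma> u) (Y b (\<gamma> u)) (Z (\<gamma> u))" for b u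
  have gY: "smooth_fun A (\<lambda>q. g q (Y b q) (Z q))" for b
    using g Y Z by (simp add: riemannian_metric_def)
  have k: "smooth_on I (k b)" for b unfolding k_def using smooth_fun_along[OF gY] .
  have dk: "deriv (k b) t = g (\<gamma> t) (nabla X (Y b) (\<gamma> t)) (Z (\<gamma> t))
      + g (\<gamma> t) (Y b (\<gamma> t)) (nabla X Z (\<gamma> t))" for b
    unfolding k_def using deriv_along[OF gY X t nz] compat[OF X(1) Y Z] by simp
  have D1: "deriv \<rho> t *\<^sub>R V t + \<rho> t *\<^sub>R D V t =
      (\<Sum>b\<in>Basis. deriv (h b) t *\<^sub>R Y b (\<gamma> t) + h b t *\<^sub>R nabla X (Y b) (\<gamma> t))"
    using D_cong[OF smooth_field_along_scaleR[OF \<rho>(1) V] eq t] D_scaleR[OF \<rho>(1) V t]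
      D_combination[OF h Y X t] by simp
  have zero: "(\<Sum>b\<in>Basis. h b u * k b u) = 0" if "u \<in> I" for u
  proof -
    have "(\<Sum>b\<in>Basis. h b u * k b u) = g (\<gamma> u) (\<rho> u *\<^sub>R V u) (Z (\<gamma> u))"
      unfolding eq[OF that] by (simp add: lin_simps k_def)
    then show ?thesis by (simp add: lin_simps orth that)
  qed
  have "((\<lambda>u. \<Sum>b\<in>Basis. h b u * k b u) has_real_derivative
      (\<Sum>b\<in>Basis. deriv (h b) t * k b t + deriv (k b) t * h b t)) (at t)"
    by (intro DERIV_sum DERIV_mult smooth_on_DERIV[OF h t] smooth_on_DERIV[OF k t])
  moreover have "((\<lambda>u. \<Sum>b\<in>Basis. h b u * k b u) has_real_derivative 0) (at t)"
    by (rule has_field_derivative_transform_within_open[OF DERIV_const open_I t]) (simp add: zero)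
  ultimately have "0 = (\<Sum>b\<in>Basis. deriv (h b) t * k b t + deriv (k b) t * h b t)"
    using DERIV_unique by blast
  also have "\<dots> = g (\<gamma> t) (\<Sum>b\<in>Basis. deriv (h b) t *\<^sub>R Y b (\<gamma> t) + h b t *\<^sub>R nabla X (Y b) (\<gamma> t)) (Z (\<gamma> t))
      + g (\<gamma> t) (\<Sum>b\<in>Basis. h b t *\<^sub>R Y b (\<gamma> t)) (nabla X Z (\<gamma> t))"
    by (simp add: lin_simps dk k_def sum.distrib algebra_simps)
  also have "\<dots> = \<rho> t * (g (\<gamma> t) (D V t) (Z (\<gamma> t)) + g (\<gamma> t) (V t) (nabla X Z (\<gamma> t)))"
    by (simp add: D1[symmetric] eq[OF t, symmetric] lin_simps orth[OF t] algebra_simps)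
  finally show ?thesis using \<rho>(2) by simp
qed

end

section \<open>Trans-\<open>S\<close>-manifolds\<close>

locale trans_S =
  fixes A :: "('a::{t2_space, second_countable_topology}, 'e::euclidean_space) chart set"
    and n s :: nat and f xi eta g nabla alpha beta
  assumes trans_S: "trans_S_manifold A n s f xi eta g nabla alpha beta"
begin

lemma framed: "framed_metric_f_manifold A n s f xi eta g"
  using trans_S by (simp add: trans_S_manifold_def)

sublocale manifold A
  by standard (use framed in \<open>simp add: framed_metric_f_manifold_def\<close>)

section \<open>Pointwise algebra of the framed structure\<close>

lemma
  shows metric: "riemannian_metric A g"
    and tensor_f: "tensor_field_1_1 A f"
    and xi_one_form: "\<forall>i\<in>{1..s}. smooth_vf A (xi i) \<and> one_form A (eta i)"
    and f_f_all: "\<forall>p v. f p (f p v) = - v + (\<Sum>i=1..s. eta i p v *\<^sub>R xi i p)"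
    and eta_xi_all: "\<forall>p. \<forall>i\<in>{1..s}. \<forall>j\<in>{1..s}. eta i p (xi j p) = (if i = j then 1 else 0)"
    and f_xi_all: "\<forall>p. \<forall>i\<in>{1..s}. f p (xi i p) = 0"
    and eta_f_all: "\<forall>p v. \<forall>i\<in>{1..s}. eta i p (f p v) = 0"
    and g_f_f_all: "\<forall>p u v. g p (f p u) (f p v) = g p u v - (\<Sum>i=1..s. eta i p u * eta i p v)"
    and eta_g_all: "\<forall>p v. \<forall>i\<in>{1..s}. eta i p v = g p v (xi i p)"
  using framed unfolding framed_metric_f_manifold_def by - ((elim conjE; assumption)+)

lemma xi: "i \<in> {1..s} \<Longrightarrow> smooth_vf A (xi i)"
  and linear_eta: "i \<in> {1..s} \<Longrightarrow> linear (eta i p)"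
  and f_f: "f p (f p v) = - v + (\<Sum>i=1..s. eta i p v *\<^sub>R xi i p)"
  and eta_xi: "i \<in> {1..s} \<Longrightarrow> j \<in> {1..s} \<Longrightarrow> eta i p (xi j p) = (if i = j then 1 else 0)"
  and f_xi: "i \<in> {1..s} \<Longrightarrow> f p (xi i p) = 0"
  and eta_f: "i \<in> {1..s} \<Longrightarrow> eta i p (f p v) = 0"
  and g_f_f: "g p (f p u) (f p v) = g p u v - (\<Sum>i=1..s. eta i p u * eta i p v)"
  and eta_g: "i \<in> {1..s} \<Longrightarrow> eta i p v = g p v (xi i p)"
  using xi_one_form f_f_all eta_xi_all f_xi_all eta_f_all g_f_f_all eta_g_all
  unfolding one_form_def by blast+

lemma linear_f: "linear (f p)"
  using tensor_f by (simp add: tensor_field_1_1_def)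

lemma g_commute: "g p u v = g p v u"
  and linear_g: "linear (\<lambda>v. g p v w)" "linear (g p w)"
  using metric by (auto simp: riemannian_metric_def bilinear_def)

lemmas f_simps = linear_add[OF linear_f] linear_diff[OF linear_f] linear_scale[OF linear_f]
  linear_0[OF linear_f] linear_neg[OF linear_f]

lemmas g_simps = linear_add[OF linear_g(1)] linear_scale[OF linear_g(1)] linear_sum[OF linear_g(1)]
  linear_0[OF linear_g(1)] linear_neg[OF linear_g(1)] linear_diff[OF linear_g(1)]
  linear_add[OF linear_g(2)] linear_scale[OF linear_g(2)] linear_sum[OF linear_g(2)]
  linear_0[OF linear_g(2)] linear_neg[OF linear_g(2)] linear_diff[OF linear_g(2)]

lemma eta_sum_xi: "k \<in> {1..s} \<Longrightarrow> eta k p (\<Sum>i=1..s. e i *\<^sub>R xi i p) = e k"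
  by (simp add: linear_sum[OF linear_eta] linear_scale[OF linear_eta] eta_xi if_distrib cong: if_cong)

text \<open>The fields \<open>xi\<close> are orthonormal, since the forms \<open>eta\<close> are
  both their metric duals and their dual frame. Norms of combinations thus become sums of squares of
  coefficients.\<close>

lemma g_sum_xi:
  "g p (\<Sum>i=1..s. e i *\<^sub>R xi i p) (\<Sum>i=1..s. d i *\<^sub>R xi i p) = (\<Sum>i=1..s. e i * d i)"
  by (simp add: linear_sum[OF linear_g(2)] linear_scale[OF linear_g(2)] eta_g[symmetric] eta_sum_xi
      mult.commute del: One_nat_def)

text \<open>Applying the metric identity to f u and v costs no correction term because
  \<open>eta\<close> vanishes on the image of \<open>f\<close>. Then f f u is expanded, and its
  \<open>xi\<close> part is orthogonal to f v.\<close>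

lemma g_f_skew: "g p (f p u) v = - g p u (f p v)"
proof -
  have "g p (f p u) v = g p (f p (f p u)) (f p v)" by (simp add: g_f_f eta_f)
  also have "\<dots> = - g p u (f p v) + (\<Sum>i=1..s. eta i p u * g p (xi i p) (f p v))"
    by (simp add: f_f g_simps)
  also have "(\<Sum>i=1..s. eta i p u * g p (xi i p) (f p v)) = 0"
    by (intro sum.neutral ballI) (simp add: g_commute[of p "xi _ p"] eta_g[symmetric] eta_f)
  finally show ?thesis by simp
qed

section \<open>Covariant derivatives of \<open>f\<close> and of the fields \<open>xi\<close>\<close>

lemma normal: "normal_structure A s f xi eta"
  using trans_S by (simp add: trans_S_manifold_def)

lemma levi_civita: "levi_civita_connection A g nabla"
  using trans_S by (simp add: trans_S_manifold_def)

lemma connection: "affine_connection A nabla"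
  and torsion_free: "smooth_vf A X \<Longrightarrow> smooth_vf A Y \<Longrightarrow> lie_bracket A X Y p = nabla X Y p - nabla Y X p"
  and compatible: "smooth_vf A X \<Longrightarrow> smooth_vf A Y \<Longrightarrow> smooth_vf A Z \<Longrightarrow>
    vf_app A X (\<lambda>q. g q (Y q) (Z q)) p = g p (nabla X Y p) (Z p) + g p (Y p) (nabla X Z p)"
  using levi_civita by (simp_all add: levi_civita_connection_def)

lemma nabla_zero_right: "smooth_vf A X \<Longrightarrow> nabla X (\<lambda>q. 0) p = 0"
proof -
  assume X: "smooth_vf A X"
  have "nabla X (\<lambda>q. 0 *\<^sub>R X q) p = vf_app A X (\<lambda>q. 0) p *\<^sub>R X p + 0 *\<^sub>R nabla X X p"
    using connection X smooth_fun_const[of 0] unfolding affine_connection_def by meson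
  then show ?thesis by (simp add: vf_app_def tangent_app_const)
qed

lemma nabla_zero_left: "smooth_vf A X \<Longrightarrow> nabla (\<lambda>q. 0) X p = 0"
proof -
  assume X: "smooth_vf A X"
  have "nabla (\<lambda>q. 0 *\<^sub>R X q) X p = 0 *\<^sub>R nabla X X p"
    using connection X smooth_fun_const[of 0] unfolding affine_connection_def by meson
  then show ?thesis by simp
qed

text \<open>The right-hand side of the trans-S equation as a function of two tangent vectors at one
  point, so that it can be evaluated on fields given along a curve only.\<close>

definition cov_f :: "'a \<Rightarrow> 'e \<Rightarrow> 'e \<Rightarrow> 'e" where
  "cov_f p u v = (\<Sum>i=1..s.
     alpha i p *\<^sub>R (g p (f p u) (f p v) *\<^sub>R xi i p + eta i p v *\<^sub>R f p (f p u))
     + beta i p *\<^sub>R (g p (f p u) v *\<^sub>R xi i p - eta i p v *\<^sub>R f p u))"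

lemma cov_deriv_f:
  "smooth_vf A X \<Longrightarrow> smooth_vf A Y \<Longrightarrow> cov_deriv_tensor nabla f X Y p = cov_f p (X p) (Y p)"
  using trans_S by (simp add: trans_S_manifold_def cov_f_def)

lemma linear_cov_f: "linear (cov_f p u)"
proof (rule linearI)
  show "cov_f p u (v + w) = cov_f p u v + cov_f p u w" for v w
    unfolding cov_f_def sum.distrib[symmetric]
    by (intro sum.cong refl) (simp add: f_simps g_simps linear_add[OF linear_eta] algebra_simps)
  show "cov_f p u (r *\<^sub>R v) = r *\<^sub>R cov_f p u v" for r v
    unfolding cov_f_def scaleR_sum_right
    by (intro sum.cong refl) (simp add: f_simps g_simps linear_scale[OF linear_eta] algebra_simps)
qed

text \<open>As \<open>f\<close> kills the field \<open>xi j\<close>, the derivative of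
  \<open>f\<close> applied to \<open>xi j\<close> is minus f of the derivative of
  \<open>xi j\<close>. In the trans-S formula both metric terms vanish and duality keeps the summand
  i = j.\<close>

lemma f_nabla_xi:
  assumes X: "smooth_vf A X" and j: "j \<in> {1..s}"
  shows "f p (nabla X (xi j) p) = - alpha j p *\<^sub>R f p (f p (X p)) + beta j p *\<^sub>R f p (X p)"
proof -
  have "(\<lambda>q. f q (xi j q)) = (\<lambda>q. 0)" using f_xi[OF j] by auto
  then have "- f p (nabla X (xi j) p) = cov_f p (X p) (xi j p)"
    using cov_deriv_f[OF X xi[OF j], of p] by (simp add: cov_deriv_tensor_def nabla_zero_right X)
  also have "\<dots> = (\<Sum>i=1..s. if i = j then alpha j p *\<^sub>R f p (f p (X p)) - beta j p *\<^sub>R f p (X p) else 0)"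
    unfolding cov_f_def
    by (intro sum.cong refl)
      (simp add: f_xi[OF j] g_simps eta_xi[OF _ j] eta_g[OF j, symmetric] eta_f[OF j])
  also have "\<dots> = alpha j p *\<^sub>R f p (f p (X p)) - beta j p *\<^sub>R f p (X p)"
    using j by simp
  finally have "f p (nabla X (xi j) p) = - (alpha j p *\<^sub>R f p (f p (X p)) - beta j p *\<^sub>R f p (X p))"
    by (metis minus_minus)
  then show ?thesis by simp
qed

text \<open>Contracting the normality condition for \<open>X\<close>, \<open>\<xi>\<^sub>j\<close> with \<open>\<eta>\<^sub>k\<close> leaves \<open>d\<eta>\<^sub>k(X, \<xi>\<^sub>j) = 0\<close>.\<close>

lemma normality_xi:
  assumes X: "smooth_vf A X" and j: "j \<in> {1..s}" and k: "k \<in> {1..s}"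
  shows "g p (xi j p) (nabla X (xi k) p) = g p (X p) (nabla (xi j) (xi k) p)"
proof -
  have f0: "(\<lambda>q. f q (xi j q)) = (\<lambda>q. 0)" using f_xi[OF j] by auto
  have fX: "smooth_vf A (\<lambda>q. f q (X q))" using tensor_f X by (simp add: tensor_field_1_1_def)
  \<comment> \<open>Of the four terms of the Nijenhuis tensor this is the only one not of the form
    f(...), hence the only one that \<open>eta k\<close> does not kill by itself.\<close>
  have "lie_bracket A (\<lambda>q. f q (X q)) (\<lambda>q. f q (xi j q)) p = 0"
    unfolding f0 by (simp add: torsion_free fX smooth_vf_zero nabla_zero_right nabla_zero_left)
  then have "eta k p (nijenhuis A f X (xi j) p) = 0"
    by (simp add: nijenhuis_def linear_add[OF linear_eta[OF k]] linear_diff[OF linear_eta[OF k]] eta_f[OF k])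
  moreover have "nijenhuis A f X (xi j) p + 2 *\<^sub>R (\<Sum>i=1..s. ext_deriv A (eta i) X (xi j) p *\<^sub>R xi i p) = 0"
    using normal X xi[OF j] unfolding normal_structure_def by blast
  then have "eta k p (nijenhuis A f X (xi j) p + 2 *\<^sub>R (\<Sum>i=1..s. ext_deriv A (eta i) X (xi j) p *\<^sub>R xi i p)) = 0"
    by (simp only: linear_0[OF linear_eta[OF k]])
  ultimately have "2 * ext_deriv A (eta k) X (xi j) p = 0"
    by (simp only: linear_add[OF linear_eta[OF k]] linear_scale[OF linear_eta[OF k]] eta_sum_xi[OF k]) simp
  moreover have "vf_app A X (\<lambda>q. eta k q (xi j q)) p = 0"
    by (simp add: eta_xi[OF k j] vf_app_def tangent_app_const)
  ultimately have 1: "vf_app A (xi j) (\<lambda>q. g q (X q) (xi k q)) p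
      + g p (nabla X (xi j) p - nabla (xi j) X p) (xi k p) = 0"
    by (simp add: ext_deriv_def torsion_free X xi[OF j] eta_g[OF k])
  \<comment> \<open>The inner product of \<open>xi j\<close> and \<open>xi k\<close> is constant.
    Differentiating it along \<open>X\<close> shifts the derivative from \<open>xi j\<close> to
    \<open>xi k\<close> with a sign; the terms with \<open>nabla (xi j) X\<close> then
    cancel.\<close>
  have "vf_app A X (\<lambda>q. g q (xi j q) (xi k q)) p = 0"
    unfolding eta_g[OF k, symmetric] by (simp add: eta_xi[OF k j] vf_app_def tangent_app_const)
  then have "g p (nabla X (xi j) p) (xi k p) = - g p (xi j p) (nabla X (xi k) p)"
    by (simp add: compatible X xi[OF j] xi[OF k])
  with 1 show ?thesis
    by (simp add: compatible X xi[OF j] xi[OF k] g_simps)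
qed

text \<open>Applying \<open>f\<close> twice recovers, up to sign, a vector without \<open>xi\<close>
  components, so these components have to vanish. By \<open>normality_xi\<close> the j-th one is the
  inner product of \<open>X\<close> with the derivative of \<open>xi k\<close> along
  \<open>xi j\<close>; \<open>f\<close> kills that derivative, hence it lies in the span of the
  \<open>xi\<close> fields, orthogonal to \<open>X\<close> at \<open>p\<close>.\<close>

lemma nabla_xi:
  assumes X: "smooth_vf A X" and horizontal: "\<And>i. i \<in> {1..s} \<Longrightarrow> eta i p (X p) = 0" and k: "k \<in> {1..s}"
  shows "nabla X (xi k) p = - alpha k p *\<^sub>R f p (X p) + beta k p *\<^sub>R X p"
proof -
  let ?W = "nabla X (xi k) p"
  have "eta j p ?W = 0" if j: "j \<in> {1..s}" for j
  proof -
    let ?U = "nabla (xi j) (xi k) p"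
    have "f p ?U = 0" using f_nabla_xi[OF xi[OF j] k] by (simp add: f_xi[OF j] f_simps)
    then have U: "?U = (\<Sum>i=1..s. eta i p ?U *\<^sub>R xi i p)"
      using f_f[of p ?U] by (simp add: f_simps)
    have "eta j p ?W = g p (X p) ?U"
      by (simp add: eta_g[OF j] g_commute[of p ?W] normality_xi[OF X j k])
    also have "\<dots> = (\<Sum>i=1..s. eta i p ?U * eta i p (X p))"
      by (subst U) (simp add: linear_sum[OF linear_g(2)] linear_scale[OF linear_g(2)] eta_g)
    finally show ?thesis by (simp add: horizontal)
  qed
  then have "?W = - f p (f p ?W)" by (simp add: f_f)
  moreover have "f p (f p (X p)) = - X p" by (simp add: f_f horizontal)
  ultimately show ?thesis by (simp add: f_nabla_xi[OF X k] f_simps)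
qed

end

theorem theorem1:
  fixes A :: "('a::{t2_space, second_countable_topology}, 'e::euclidean_space) chart set"
    and n s r :: nat
    and f :: "'a \<Rightarrow> 'e \<Rightarrow> 'e"
    and xi :: "nat \<Rightarrow> 'a \<Rightarrow> 'e"
    and eta :: "nat \<Rightarrow> 'a \<Rightarrow> 'e \<Rightarrow> real"
    and g :: "'a \<Rightarrow> 'e \<Rightarrow> 'e \<Rightarrow> real"
    and nabla :: "('a \<Rightarrow> 'e) \<Rightarrow> ('a \<Rightarrow> 'e) \<Rightarrow> 'a \<Rightarrow> 'e"
    and alpha beta :: "nat \<Rightarrow> 'a \<Rightarrow> real"
    and q \<delta> :: real
    and I :: "real set"
    and \<gamma> :: "real \<Rightarrow> 'a"
    and T :: "real \<Rightarrow> 'e"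
    and D :: "(real \<Rightarrow> 'e) \<Rightarrow> real \<Rightarrow> 'e"
    and E :: "nat \<Rightarrow> real \<Rightarrow> 'e"
    and \<kappa> :: "nat \<Rightarrow> real \<Rightarrow> real"
    and a :: "real \<Rightarrow> real"
  assumes trans_S: "trans_S_manifold A n s f xi eta g nabla alpha beta"
    and q: "q \<noteq> 0"
    and delta: "\<delta> = sgn (- q)"
    and D: "cov_deriv_along A nabla I \<gamma> D"
    and frenet: "frenet_curve A g I \<gamma> D r E \<kappa>"
    and legendre: "legendre_curve A s eta g I \<gamma>"
    and T: "T = velocity A \<gamma>"
    and trajectory: "\<forall>t\<in>I. D T t = - (q *\<^sub>R f (\<gamma> t) (T t))"
    and a: "a = (\<lambda>t. sqrt (\<Sum>j=1..s. (alpha j (\<gamma> t))\<^sup>2))"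
  shows
    "(legendre_curve A s eta g I \<gamma> \<and> frenet_circle A g I \<gamma> D r E \<kappa> \<and>
      (\<forall>t\<in>I. \<kappa> 1 t = \<bar>q\<bar> \<and> E 1 t = T t \<and> E 2 t = \<delta> *\<^sub>R f (\<gamma> t) (T t) \<and>
         (\<forall>i\<in>{1..s}. alpha i (\<gamma> t) = 0 \<and> beta i (\<gamma> t) = 0)))
     \<or>
     (legendre_curve A s eta g I \<gamma> \<and> frenet_curve A g I \<gamma> D r E \<kappa> \<and> r \<ge> 3 \<and>
      (\<forall>t\<in>I.
         \<kappa> 1 t = \<bar>q\<bar> \<and>
         \<kappa> 2 t = a t \<and>
         (if r = 3 then 0 else \<kappa> 3 t) =
           sqrt (\<Sum>i=1..s. (deriv (\<lambda>u. alpha i (\<gamma> u) / a u) t)\<^sup>2) \<and>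
         E 1 t = T t \<and>
         E 2 t = \<delta> *\<^sub>R f (\<gamma> t) (T t) \<and>
         E 3 t = (\<delta> / a t) *\<^sub>R (\<Sum>i=1..s. alpha i (\<gamma> t) *\<^sub>R xi i (\<gamma> t)) \<and>
         (r \<ge> 4 \<longrightarrow>
           \<kappa> 3 t *\<^sub>R E 4 t =
             \<delta> *\<^sub>R (\<Sum>i=1..s. deriv (\<lambda>u. alpha i (\<gamma> u) / a u) t *\<^sub>R xi i (\<gamma> t))) \<and>
         (\<exists>i\<in>{1..s}. alpha i (\<gamma> t) \<noteq> 0) \<and>
         (\<forall>i\<in>{1..s}. beta i (\<gamma> t) = 0)) \<and>
      (r = 3 \<longrightarrow>
         (\<exists>c :: nat \<Rightarrow> real. (\<Sum>i=1..s. (c i)\<^sup>2) = 1 \<and>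
            (\<forall>t\<in>I. \<forall>i\<in>{1..s}. alpha i (\<gamma> t) = c i * a t))))"
proof -
  interpret trans_S A n s f xi eta g nabla alpha beta
    by standard (rule trans_S)
  interpret covariant_curve A I \<gamma> nabla D
    by standard (use legendre D connection in \<open>auto simp: legendre_curve_def\<close>)
  \<comment> \<open>This is the value of \<open>cov_f\<close> on the pair \<open>T\<close>,
    \<open>T\<close>, because \<open>T\<close> is horizontal and of unit length.\<close>
  define S where "S t = (\<Sum>i=1..s. alpha i (\<gamma> t) *\<^sub>R xi i (\<gamma> t))" for t
  have unit: "g (\<gamma> t) (T t) (T t) = 1" and horizontal: "\<And>i. i \<in> {1..s} \<Longrightarrow> eta i (\<gamma> t) (T t) = 0"
    if "t \<in> I" for t
    using legendre that by (auto simp: legendre_curve_def T)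
  have T_nz: "velocity A \<gamma> t \<noteq> 0" if "t \<in> I" for t
    using unit[OF that] g_simps(4)[of "\<gamma> t"] by (auto simp: T)
  have f_f_T: "f (\<gamma> t) (f (\<gamma> t) (T t)) = - T t" if "t \<in> I" for t
    by (simp add: f_f horizontal that)
  have g_fT: "g (\<gamma> t) (f (\<gamma> t) (T t)) (f (\<gamma> t) (T t)) = 1" if "t \<in> I" for t
    by (simp add: g_f_f horizontal unit that)
  have g_fT_T: "g (\<gamma> t) (f (\<gamma> t) (T t)) (T t) = 0" for t
    using g_f_skew[of "\<gamma> t" "T t" "T t"] g_commute[of "\<gamma> t" "T t" "f (\<gamma> t) (T t)"] by simp
  have delta_abs: "\<delta> * q = - \<bar>q\<bar>" "\<bar>q\<bar> * \<delta> = - q" "\<delta> * \<delta> = 1"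
    using q by (auto simp: delta sgn_real_def)

  \<comment> \<open>The first Frenet equation\<close>
  have r1: "r \<ge> 1"
    and E_smooth: "\<And>j. j \<in> {1..r} \<Longrightarrow> smooth_field_along A I \<gamma> (E j)"
    and E1: "\<And>t. t \<in> I \<Longrightarrow> E 1 t = T t"
    and E_orth: "\<And>t i j. t \<in> I \<Longrightarrow> i \<in> {1..r} \<Longrightarrow> j \<in> {1..r} \<Longrightarrow>
      g (\<gamma> t) (E i t) (E j t) = (if i = j then 1 else 0)"
    and \<kappa>_pos: "\<And>t j. t \<in> I \<Longrightarrow> j \<in> {1..<r} \<Longrightarrow> \<kappa> j t > 0"
    and D_E: "\<And>t j. t \<in> I \<Longrightarrow> j \<in> {1..r} \<Longrightarrow> D (E j) t =
        (if j = 1 then 0 else - (\<kappa> (j - 1) t *\<^sub>R E (j - 1) t)) +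
        (if j = r then 0 else \<kappa> j t *\<^sub>R E (j + 1) t)"
    using frenet unfolding frenet_curve_def T by blast+
  have T_smooth: "smooth_field_along A I \<gamma> T"
    using smooth_field_along_cong[OF E1 E_smooth] r1 by simp
  have D_E1: "D (E 1) t = - (q *\<^sub>R f (\<gamma> t) (T t))" if "t \<in> I" for t
    using D_cong[OF E_smooth E1 that] trajectory r1 that by simp
  obtain t0 where t0: "t0 \<in> I" using legendre by (auto simp: legendre_curve_def smooth_curve_def)
  have r2: "r \<ge> 2"
  proof (rule ccontr)
    assume "\<not> r \<ge> 2"
    then have "q *\<^sub>R f (\<gamma> t0) (T t0) = 0"
      using D_E1[OF t0] D_E[OF t0, of 1] r1 by simp
    then have "f (\<gamma> t0) (T t0) = 0" using q by simp
    then show False using g_fT[OF t0] g_simps(4)[of "\<gamma> t0"] by simp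
  qed
  have \<kappa>E2: "\<kappa> 1 t *\<^sub>R E 2 t = - (q *\<^sub>R f (\<gamma> t) (T t))" if "t \<in> I" for t
    using D_E1[OF that] D_E[OF that, of 1] r2 by (simp add: numeral_2_eq_2)
  have \<kappa>1: "\<kappa> 1 t = \<bar>q\<bar>" if "t \<in> I" for t
  proof -
    have "\<kappa> 1 t * (\<kappa> 1 t * g (\<gamma> t) (E 2 t) (E 2 t)) = q * (q * g (\<gamma> t) (f (\<gamma> t) (T t)) (f (\<gamma> t) (T t)))"
      using arg_cong[OF \<kappa>E2[OF that], of "\<lambda>v. g (\<gamma> t) v v"] by (simp add: g_simps)
    then have "(\<kappa> 1 t)\<^sup>2 = q\<^sup>2"
      using E_orth[OF that, of 2 2] r2 by (simp add: g_fT[OF that] power2_eq_square)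
    moreover have "\<kappa> 1 t > 0" using \<kappa>_pos[OF that, of 1] r2 by simp
    ultimately show ?thesis by (metis abs_of_pos power2_eq_iff abs_minus_cancel)
  qed
  \<comment> \<open>Dividing -q by the positive curvature |q| leaves the sign \<delta>.\<close>
  have E2: "E 2 t = \<delta> *\<^sub>R f (\<gamma> t) (T t)" if "t \<in> I" for t
  proof -
    have "\<bar>q\<bar> *\<^sub>R E 2 t = \<bar>q\<bar> *\<^sub>R (\<delta> *\<^sub>R f (\<gamma> t) (T t))"
      using \<kappa>E2[OF that] by (simp add: \<kappa>1[OF that, simplified] delta_abs)
    then show ?thesis by (rule scaleR_left_imp_eq[rotated]) (simp add: q)
  qed

  \<comment> \<open>The second Frenet equation and the vanishing of the \<beta> functions\<close>
  have fT_smooth: "smooth_field_along A I \<gamma> (\<lambda>u. f (\<gamma> u) (T u))"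
  \<comment> \<open>Smoothness of f T is read off from the frame field \<open>E 2\<close>, since the
    tensor property of \<open>f\<close> speaks of global vector fields only.\<close>
  proof (rule smooth_field_along_cong)
    show "\<delta> *\<^sub>R E 2 u = f (\<gamma> u) (T u)" if "u \<in> I" for u
      by (simp add: E2[OF that] delta_abs)
    show "smooth_field_along A I \<gamma> (\<lambda>u. \<delta> *\<^sub>R E 2 u)"
      using E_smooth[of 2] r2 by (intro smooth_field_along_scaleR smooth_on_const) auto
  qed
  have D_fT: "D (\<lambda>u. f (\<gamma> u) (T u)) t = S t + q *\<^sub>R T t" if t: "t \<in> I" for t
  proof -
    obtain X where X: "smooth_vf A X" "X (\<gamma> t) = velocity A \<gamma> t" by (rule smooth_vf_extension)
    have "D (\<lambda>u. f (\<gamma> u) (T u)) t = cov_f (\<gamma> t) (T t) (T t) + f (\<gamma> t) (D T t)"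
      using D_tensor[OF tensor_f T_smooth fT_smooth X t linear_cov_f cov_deriv_f[OF X(1)]]
      by (simp add: X(2) T)
    \<comment> \<open>Horizontality of \<open>T\<close> removes the terms with \<open>eta\<close>.
      The metric factor of \<alpha> is 1 because f T is a unit vector, that of \<beta> is 0 because
      f T is orthogonal to \<open>T\<close>.\<close>
    moreover have "cov_f (\<gamma> t) (T t) (T t) = S t"
      unfolding cov_f_def S_def
      by (intro sum.cong refl) (simp add: horizontal t g_fT g_fT_T)
    moreover have "f (\<gamma> t) (D T t) = q *\<^sub>R T t"
      using trajectory t by (simp add: f_simps f_f_T)
    ultimately show ?thesis by simp
  qed
  have nabla_xi_T: "nabla X (xi i) (\<gamma> t) = - alpha i (\<gamma> t) *\<^sub>R f (\<gamma> t) (T t) + beta i (\<gamma> t) *\<^sub>R T t"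
    if "t \<in> I" "smooth_vf A X" "X (\<gamma> t) = velocity A \<gamma> t" "i \<in> {1..s}" for t X i
    using nabla_xi[OF that(2) _ that(4), of "\<gamma> t"] horizontal[OF that(1)] that(3) by (simp add: T)
  have beta: "beta i (\<gamma> t) = 0" if t: "t \<in> I" and i: "i \<in> {1..s}" for t i
  proof -
    obtain X where X: "smooth_vf A X" "X (\<gamma> t) = velocity A \<gamma> t" by (rule smooth_vf_extension)
    have orth: "g (\<gamma> u) (T u) (xi i (\<gamma> u)) = 0" if "u \<in> I" for u
      using horizontal[OF that i] eta_g[OF i, of "\<gamma> u" "T u"] by simp
    \<comment> \<open>The first term is zero since the derivative of \<open>T\<close> is a multiple
      of f T; in the second only the component \<beta> along \<open>T\<close> survives.\<close>
    have "g (\<gamma> t) (D T t) (xi i (\<gamma> t)) + g (\<gamma> t) (T t) (nabla X (xi i) (\<gamma> t)) = 0"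
      by (rule D_orthogonal[OF metric compatible T_smooth xi[OF i] _ X t T_nz[OF t]])
        (simp_all add: orth)
    moreover have "g (\<gamma> t) (D T t) (xi i (\<gamma> t)) = 0"
      using trajectory t eta_f[OF i, of "\<gamma> t" "T t"] by (simp add: g_simps eta_g[OF i])
    ultimately show ?thesis
      using g_fT_T[of t] g_commute[of "\<gamma> t" "T t" "f (\<gamma> t) (T t)"]
      by (simp add: nabla_xi_T[OF t X i] g_simps unit t)
  qed
  \<comment> \<open>Two expressions for the derivative of \<open>E 2\<close> are compared, and the
    multiples of \<open>T\<close> cancel by the value of the first curvature. For r = 2 the frame
    ends, so the next Frenet term is zero.\<close>
  have E3_eq: "(if r = 2 then 0 else \<kappa> 2 t *\<^sub>R E 3 t) = \<delta> *\<^sub>R S t" if t: "t \<in> I" for t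
  proof -
    have "D (E 2) t = \<delta> *\<^sub>R D (\<lambda>u. f (\<gamma> u) (T u)) t"
      using D_cong[OF _ E2 t] E_smooth[of 2] r2 by (simp add: D_const_scaleR fT_smooth t)
    also have "\<dots> = \<delta> *\<^sub>R S t - \<bar>q\<bar> *\<^sub>R T t"
      by (simp add: D_fT[OF t] scaleR_add_right delta_abs)
    finally show ?thesis
      using D_E[OF t, of 2] r2 \<kappa>1[OF t] E1[OF t] by (auto simp: numeral_3_eq_3)
  qed
  show ?thesis
  proof (cases "r = 2")
    case True

    \<comment> \<open>Osculating order two\<close>
    have alpha: "alpha i (\<gamma> t) = 0" if "t \<in> I" "i \<in> {1..s}" for t i
    proof -
      have "S t = 0" using E3_eq[OF that(1)] True delta_abs(3) by auto
      then show ?thesis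
        using eta_sum_xi[OF that(2), of "\<gamma> t" "\<lambda>i. alpha i (\<gamma> t)"] linear_0[OF linear_eta[OF that(2)]]
        by (simp add: S_def)
    qed
    have circle: "frenet_circle A g I \<gamma> D r E \<kappa>"
      unfolding frenet_circle_def using frenet True \<kappa>1 q by (intro conjI exI[of _ "\<bar>q\<bar>"]) auto
    show ?thesis
      by (intro disjI1 conjI ballI; (assumption | rule legendre circle \<kappa>1 E1 E2 alpha beta)+)
  next
    case False

    \<comment> \<open>Osculating order at least three\<close>
    then have r3: "r \<ge> 3" using r2 by simp
    have a_sq: "(\<Sum>i=1..s. alpha i (\<gamma> t) * alpha i (\<gamma> t)) = a t * a t" for t
      unfolding a by (simp add: sum_nonneg power2_eq_square)
    have \<kappa>2: "\<kappa> 2 t = a t" if t: "t \<in> I" for t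
    proof -
      have "\<kappa> 2 t * (\<kappa> 2 t * g (\<gamma> t) (E 3 t) (E 3 t)) = \<delta> * (\<delta> * g (\<gamma> t) (S t) (S t))"
        using arg_cong[OF E3_eq[OF t], of "\<lambda>v. g (\<gamma> t) v v"] False by (simp add: g_simps)
      then have "(\<kappa> 2 t)\<^sup>2 = (a t)\<^sup>2"
        using E_orth[OF t, of 3 3] r3 a_sq[of t] unfolding S_def g_sum_xi
        by (simp add: power2_eq_square delta_abs flip: mult.assoc)
      moreover have "\<kappa> 2 t > 0" using \<kappa>_pos[OF t, of 2] r3 by simp
      moreover have "a t \<ge> 0" by (simp add: a sum_nonneg)
      ultimately show ?thesis by (simp add: power2_eq_iff_nonneg)
    qed
    \<comment> \<open>Positivity of \<open>a\<close> is inherited from the second Frenet curvature,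
      which is positive once r is at least 3. It justifies the divisions by
      \<open>a\<close>.\<close>
    have a_pos: "a t > 0" if "t \<in> I" for t
      using \<kappa>2[OF that] \<kappa>_pos[OF that, of 2] r3 by simp
    have E3: "E 3 t = (\<delta> / a t) *\<^sub>R S t" if t: "t \<in> I" for t
    proof -
      have "a t *\<^sub>R E 3 t = a t *\<^sub>R ((\<delta> / a t) *\<^sub>R S t)"
        using E3_eq[OF t] False \<kappa>2[OF t] a_pos[OF t] by simp
      then show ?thesis by (rule scaleR_left_imp_eq[rotated]) (use a_pos[OF t] in simp)
    qed
    have alpha_nz: "\<exists>i\<in>{1..s}. alpha i (\<gamma> t) \<noteq> 0" if t: "t \<in> I" for t
    proof (rule ccontr)
      assume "\<not> ?thesis"
      then have "a t = 0" by (simp add: a)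
      then show False using a_pos[OF t] by simp
    qed
    \<comment> \<open>Up to the factor \<delta>, these are the components of \<open>E 3\<close> in
      the orthonormal fields \<open>xi\<close>.\<close>
    define h where "h i = (\<lambda>u. alpha i (\<gamma> u) / a u)" for i
    have alpha_smooth: "smooth_on I (\<lambda>u. alpha i (\<gamma> u))" if "i \<in> {1..s}" for i
      using trans_S that smooth_fun_along unfolding trans_S_manifold_def by blast
    have h_smooth: "smooth_on I (h i)" if i: "i \<in> {1..s}" for i
    proof -
      have "0 < (\<Sum>j=1..s. (alpha j (\<gamma> u))\<^sup>2)" if "u \<in> I" for u
        using a_pos[OF that] by (simp add: a)
      then show ?thesis
        unfolding h_def a
        using smooth_on_divide_norm[OF open_I, of "{1..s}" "\<lambda>j u. alpha j (\<gamma> u)" i] alpha_smooth i by simp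
    qed
    have E3_h: "E 3 u = \<delta> *\<^sub>R (\<Sum>i=1..s. h i u *\<^sub>R xi i (\<gamma> u))" if "u \<in> I" for u
      by (simp add: E3[OF that] S_def h_def scaleR_sum_right)
    have E4: "(if r = 3 then 0 else \<kappa> 3 t *\<^sub>R E 4 t) = \<delta> *\<^sub>R (\<Sum>i=1..s. deriv (h i) t *\<^sub>R xi i (\<gamma> t))"
      if t: "t \<in> I" for t
    proof -
      obtain X where X: "smooth_vf A X" "X (\<gamma> t) = velocity A \<gamma> t" by (rule smooth_vf_extension)
      have "D (E 3) t = \<delta> *\<^sub>R (\<Sum>i=1..s. deriv (h i) t *\<^sub>R xi i (\<gamma> t) + h i t *\<^sub>R nabla X (xi i) (\<gamma> t))"
      proof -
        have "D (E 3) t = D (\<lambda>u. \<delta> *\<^sub>R (\<Sum>i=1..s. h i u *\<^sub>R xi i (\<gamma> u))) t"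
          using r3 by (intro D_cong[OF E_smooth E3_h t]) auto
        also have "\<dots> = \<delta> *\<^sub>R D (\<lambda>u. \<Sum>i=1..s. h i u *\<^sub>R xi i (\<gamma> u)) t"
          by (intro D_const_scaleR smooth_field_along_sum smooth_field_along_scaleR smooth_vf_along
              h_smooth xi t)
        also have "D (\<lambda>u. \<Sum>i=1..s. h i u *\<^sub>R xi i (\<gamma> u)) t =
            (\<Sum>i=1..s. deriv (h i) t *\<^sub>R xi i (\<gamma> t) + h i t *\<^sub>R nabla X (xi i) (\<gamma> t))"
          by (rule D_combination[OF h_smooth _ X t]) (simp_all add: xi)
        finally show ?thesis .
      qed
      also have "\<dots> = \<delta> *\<^sub>R (\<Sum>i=1..s. deriv (h i) t *\<^sub>R xi i (\<gamma> t))
          - (\<Sum>i=1..s. h i t * alpha i (\<gamma> t)) *\<^sub>R (\<delta> *\<^sub>R f (\<gamma> t) (T t))"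
      proof -
        have "(\<Sum>i=1..s. deriv (h i) t *\<^sub>R xi i (\<gamma> t) + h i t *\<^sub>R nabla X (xi i) (\<gamma> t)) =
            (\<Sum>i=1..s. deriv (h i) t *\<^sub>R xi i (\<gamma> t))
            - (\<Sum>i=1..s. h i t * alpha i (\<gamma> t)) *\<^sub>R f (\<gamma> t) (T t)"
          unfolding scaleR_sum_left sum_subtractf[symmetric]
          by (intro sum.cong refl) (simp add: nabla_xi_T[OF t X] beta[OF t])
        then show ?thesis by (simp only: scaleR_diff_right scaleR_left_commute)
      qed
      \<comment> \<open>This turns the f T term into \<open>- (a t *\<^sub>R E 2 t)\<close>, the
        backward term of the Frenet equation for \<open>E 3\<close>; what remains is the
        \<open>E 4\<close> term.\<close>
      also have "(\<Sum>i=1..s. h i t * alpha i (\<gamma> t)) = a t"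
        using a_sq[of t] a_pos[OF t] by (simp add: h_def flip: sum_divide_distrib)
      finally show ?thesis
        using D_E[OF t, of 3] r3 \<kappa>2[OF t] E2[OF t] by auto
    qed
    have \<kappa>3: "(if r = 3 then 0 else \<kappa> 3 t) = sqrt (\<Sum>i=1..s. (deriv (h i) t)\<^sup>2)" if t: "t \<in> I" for t
    proof -
      \<comment> \<open>Setting the third curvature to zero for r = 3 lets the single identity
        \<open>sq\<close> serve both cases.\<close>
      define k where "k = (if r = 3 then 0 else \<kappa> 3 t)"
      have sq: "k * k = (\<Sum>i=1..s. deriv (h i) t * deriv (h i) t)"
      proof (cases "r = 3")
        case True
        then have "(\<Sum>i=1..s. deriv (h i) t *\<^sub>R xi i (\<gamma> t)) = 0"
          using E4[OF t] delta_abs(3) by auto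
        then have "(\<Sum>i=1..s. deriv (h i) t * deriv (h i) t) = g (\<gamma> t) 0 0"
          using g_sum_xi[of "\<gamma> t" "\<lambda>i. deriv (h i) t" "\<lambda>i. deriv (h i) t"] by simp
        then show ?thesis using True by (simp add: g_simps k_def)
      next
        case False
        then have "\<kappa> 3 t * (\<kappa> 3 t * g (\<gamma> t) (E 4 t) (E 4 t)) =
            \<delta> * (\<delta> * (\<Sum>i=1..s. deriv (h i) t * deriv (h i) t))"
          using arg_cong[OF E4[OF t], of "\<lambda>v. g (\<gamma> t) v v"]
            g_sum_xi[of "\<gamma> t" "\<lambda>i. deriv (h i) t" "\<lambda>i. deriv (h i) t"]
          by (simp add: linear_scale[OF linear_g(1)] linear_scale[OF linear_g(2)])
        then show ?thesis
          using E_orth[OF t, of 4 4] r3 False by (simp add: k_def delta_abs flip: mult.assoc)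
      qed
      have "k \<ge> 0" using \<kappa>_pos[OF t, of 3] r3 by (auto simp: k_def intro: less_imp_le)
      then have "k = sqrt (k * k)" by simp
      then show ?thesis by (simp only: sq power2_eq_square flip: k_def)
    qed
    have const: "\<exists>c :: nat \<Rightarrow> real. (\<Sum>i=1..s. (c i)\<^sup>2) = 1 \<and>
        (\<forall>t\<in>I. \<forall>i\<in>{1..s}. alpha i (\<gamma> t) = c i * a t)" if "r = 3"
    \<comment> \<open>For r = 3 the curvature formula forces each \<open>h i\<close> to have
      derivative zero. It is then constant on the interval \<open>I\<close>, and its value at
      \<open>t0\<close> is the constant sought.\<close>
    proof (intro exI[of _ "\<lambda>i. h i t0"] conjI ballI)
      have "(\<Sum>i=1..s. (h i t0)\<^sup>2) = (\<Sum>i=1..s. alpha i (\<gamma> t0) * alpha i (\<gamma> t0)) / (a t0 * a t0)"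
        unfolding sum_divide_distrib by (intro sum.cong refl) (simp add: h_def power2_eq_square)
      then show "(\<Sum>i=1..s. (h i t0)\<^sup>2) = 1"
        using a_pos[OF t0] by (simp only: a_sq) simp
      fix t i assume t: "t \<in> I" and i: "i \<in> {1..s}"
      have "deriv (h i) u = 0" if u: "u \<in> I" for u
      proof -
        have "(\<Sum>i=1..s. (deriv (h i) u)\<^sup>2) = 0"
          using \<kappa>3[OF u] \<open>r = 3\<close> by simp
        then show ?thesis using i by (subst (asm) sum_nonneg_eq_0_iff) auto
      qed
      then have "(h i has_field_derivative 0) (at u within I)" if "u \<in> I" for u
        using smooth_on_DERIV[OF h_smooth[OF i] that] that
        by (metis has_field_derivative_at_within)
      moreover have "convex I"
        using curve by (simp add: smooth_curve_def is_interval_convex)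
      ultimately have "h i t = h i t0"
        using has_field_derivative_zero_constant[of I "h i"] t t0 by metis
      then show "alpha i (\<gamma> t) = h i t0 * a t"
        using a_pos[OF t] by (simp add: h_def field_simps)
    qed
    have E4': "\<kappa> 3 t *\<^sub>R E 4 t = \<delta> *\<^sub>R (\<Sum>i=1..s. deriv (h i) t *\<^sub>R xi i (\<gamma> t))"
      if "t \<in> I" "r \<ge> 4" for t
      using E4[OF that(1)] that(2) by simp
    show ?thesis
      by (intro disjI2 conjI impI ballI; (assumption | rule legendre frenet r3 \<kappa>1 \<kappa>2 E1 E2 alpha_nz beta const
            \<kappa>3[unfolded h_def] E3[unfolded S_def] E4'[unfolded h_def])+)
  qed
qed

end
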